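(* Let $g\in\mathbb{C}$ and let $R(z,\mu)$ be an $R$-matrix satisfying properties (i)–(iv) listed in the context. For $\xi\in V$ let $y_\xi=y_\xi(\lambda)=\sum_{i=1}^n\xi_i\,y_i$, where $y_i=\hbar\,\frac{\partial}{\partial x_i}-g\sum_{j\neq i}R_{ij}(x_i-x_j,\lambda_i-\lambda_j)\,\widehat{s}_{ij}$, be the $R$-matrix Dunkl operators, viewed as $\lambda$-dependent elements of $\mathcal D_U(V)*\widehat W$. Then: 1. (Commutativity) $[y_\xi,y_\eta]=0$ for any $\xi,\eta\in V$. 2. (Equivariance) $\widehat w\,y_\xi(\lambda)\,\widehat w^{-1}=y_{w.\xi}(w.\lambda)$ for all $w\in W$ and $\xi\in V$.
   Context: Everything is over $\mathbb{C}$. $W=S_n$ acts on $V=\mathbb{C}^n$ (coordinates $x_1,\dots,x_n$) by permuting the standard basis vectors. $\mathbb{C}(V)$ is the space of meromorphic functions on $V$, with $(w.f)(v)=f(w^{-1}.v)$; $\mathcal D(V)$ is the ring of differential operators on $V$ with meromorphic coefficients, with $w.\partial_\xi=\partial_{w.\xi}$. $\hbar$ is a complex parameter. $U=U_1\otimes\cdots\otimes U_n$ with each $U_i\cong\mathbb{C}^d$, and $W$ acts on $U$ by permuting tensor factors. $\mathcal D_U(V)=\mathcal D(V)\otimes\mathrm{End}\,U$. The group $\widehat W=\{\widehat w : w\in W\}\cong W$ acts on $\mathcal D_U(V)$ by automorphisms $\widehat w.(a\otimes b)=(w.a)\otimes(w\,b\,w^{-1})$, and $\mathcal D_U(V)*\widehat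 W$ is the corresponding crossed product (elements are uniquely $\sum_w a_w\widehat w$ with $a_w\in\mathcal D_U(V)$, and $\widehat w\,a=(\widehat w.a)\,\widehat w$). $s_{ij}\in W$ is the transposition of $i$ and $j$. The variables $\lambda=(\lambda_1,\dots,\lambda_n)$ are additional spectral parameters, which commute with everything (in particular $\widehat w$ does not act on them); $w.\lambda$ denotes the permutation action of $W$ on $\mathbb{C}^n$, i.e. $(w.\lambda)_{w(i)}=\lambda_i$. $R:\mathbb{C}^2\to\mathrm{End}(\mathbb{C}^d\otimes\mathbb{C}^d)$ is meromorphic, $R_{ij}(z,\mu)\in\mathrm{End}\,U$ acts as $R(z,\mu)$ on $U_i\otimes U_j$ and as the identity on the other factors; $P$ is the permutation operator on $\mathbb{C}^d\otimes\mathbb{C}^d$. The assumptions on $R$ are: (i) skew symmetry: $R(-z,-\mu)=-P\,R(z,\mu)\,P$; (ii) associative Yang–Baxter equation: $R_{12}(z,\mu)R_{23}(z',\mu')=R_{13}(z+z',\mu')R_{12}(z,\mu-\mu')+R_{23}(z',\mu'-\mu)R_{13}(z+z',\mu)$; (iii) unitarity: $R(z,\mu)\,R_{21}(-z,\mu)=(\wp(\mu)-\wp(z))\,\mathrm{Id}$, where $R_{21}=PRP$ and $\wp$ is the Weierstrass elliptic function or any of its degenerations; (iv) regularity: as a function of $\mu$, $R(z,\mu)$ has a first order pole at $\mu=0$ with residue independent of $z$. *)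

theory Defs
  imports "HOL-Complex_Analysis.Complex_Analysis" "HOL-Combinatorics.Perm"
begin

unbundle permutation_syntax

section \<open>Meromorphic functions of several variables\<close>

text \<open>Holomorphy of functions on open subsets of $\mathbb{C}^n$: real Frechet
  differentiability with a $\mathbb{C}$-linear derivative.\<close>

definition holo_on :: "(complex ^ 'n \<Rightarrow> complex) \<Rightarrow> (complex ^ 'n) set \<Rightarrow> bool" where
  "holo_on f S \<longleftrightarrow>
     (\<forall>x\<in>S. \<exists>f'. (f has_derivative f') (at x) \<and> (\<forall>c v. f' (c *s v) = c * f' v))"

definition pderiv_at :: "'n \<Rightarrow> (complex ^ 'n \<Rightarrow> complex) \<Rightarrow> complex ^ 'n \<Rightarrow> complex" where
  "pderiv_at i f x = deriv (\<lambda>t. f (x + t *s axis i 1)) 0"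

lemma bl_smult_axis: "bounded_linear (\<lambda>t::complex. t *s axis i (1::complex) :: complex ^ 'n)"
proof -
  have "linear (\<lambda>t::complex. t *s axis i (1::complex) :: complex ^ 'n)"
    by (rule linearI) (auto simp: vec_eq_iff algebra_simps axis_def)
  thus ?thesis by (simp add: linear_conv_bounded_linear)
qed

lemma norm_smult_axis: "norm (u *s axis i (1::complex) :: complex ^ 'n) = norm u"
proof -
  have "(norm ((u *s axis i (1::complex) :: complex ^ 'n) $ j))\<^sup>2 = (if j = i then (norm u)\<^sup>2 else 0)" for j
    by (auto simp: axis_def)
  thus ?thesis by (simp add: norm_vec_def L2_set_def)
qed

lemma holo_on_deriv_sum:
  fixes f :: "complex ^ 'n \<Rightarrow> complex"
  assumes "(f has_derivative f') (at x)" "\<And>c v. f' (c *s v) = c * f' v"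
  shows "((\<lambda>t. f (x + t *s axis i 1)) has_field_derivative f' (axis i 1)) (at 0)"
        "pderiv_at i f x = f' (axis i 1)"
        "f' v = (\<Sum>j\<in>UNIV. v $ j * pderiv_at j f x)"
proof -
  have D: "((\<lambda>t. f (x + t *s axis i 1)) has_field_derivative f' (axis i 1)) (at 0)" for i
  proof -
    have g: "((\<lambda>t::complex. x + t *s axis i 1) has_derivative (\<lambda>t. t *s axis i 1)) (at 0)"
      by (rule has_derivative_eq_rhs[OF has_derivative_add[OF has_derivative_const bounded_linear_imp_has_derivative[OF bl_smult_axis]]]) simp
    have "((\<lambda>t. f (x + t *s axis i 1)) has_derivative (\<lambda>t. f' (t *s axis i 1))) (at 0)"
      using has_derivative_compose[OF g, of f f'] assms(1) by simp
    moreover have "(\<lambda>t. f' (t *s axis i 1)) = (*) (f' (axis i 1))"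
      by (auto simp: assms(2) fun_eq_iff)
    ultimately show ?thesis by (simp add: has_field_derivative_def)
  qed
  show "((\<lambda>t. f (x + t *s axis i 1)) has_field_derivative f' (axis i 1)) (at 0)" by (rule D)
  have P: "pderiv_at i f x = f' (axis i 1)" for i
    unfolding pderiv_at_def by (rule DERIV_imp_deriv[OF D])
  show "pderiv_at i f x = f' (axis i 1)" by (rule P)
  have lin: "linear f'" using assms(1) has_derivative_linear by blast
  have "v = (\<Sum>j\<in>UNIV. (v $ j) *s axis j 1)"
    by (simp add: vec_eq_iff axis_def if_distrib sum.delta cong: if_cong)
  hence "f' v = f' (\<Sum>j\<in>UNIV. (v $ j) *s axis j 1)" by simp
  also have "\<dots> = (\<Sum>j\<in>UNIV. f' ((v $ j) *s axis j 1))" using linear_sum[OF lin] by blast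
  finally show "f' v = (\<Sum>j\<in>UNIV. v $ j * pderiv_at j f x)" by (simp add: assms(2) P)
qed

lemma holo_on_imp_continuous_on: "holo_on f S \<Longrightarrow> continuous_on S f"
  unfolding holo_on_def by (meson continuous_at_imp_continuous_on has_derivative_continuous)

lemma pderiv_at_integral:
  fixes f :: "complex ^ 'n \<Rightarrow> complex"
  assumes f: "holo_on f S" and r: "r > 0" and sub: "cball x r \<subseteq> S"
  shows "pderiv_at i f x =
    integral (cbox 0 1) (\<lambda>t::real. f (x + (circlepath 0 r t) *s axis i 1) / circlepath 0 r t)"
proof -
  let ?h = "\<lambda>u. f (x + u *s axis i 1)"
  have inS: "x + u *s axis i 1 \<in> S" if "u \<in> cball 0 r" for u
  proof -
    show ?thesis using that sub norm_smult_axis[of u i] by (auto simp: dist_norm)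
  qed
  have dh: "\<exists>d. (?h has_field_derivative d) (at u)" if u: "u \<in> cball 0 r" for u
  proof -
    obtain f' where f': "(f has_derivative f') (at (x + u *s axis i 1))" "\<And>c v. f' (c *s v) = c * f' v"
      using f inS[OF u] unfolding holo_on_def by blast
    have "((\<lambda>t. f (x + u *s axis i 1 + t *s axis i 1)) has_field_derivative f' (axis i 1)) (at 0)"
      by (rule holo_on_deriv_sum(1)[OF f'])
    hence "((\<lambda>t. f (x + (u + t) *s axis i 1)) has_field_derivative f' (axis i 1)) (at 0)"
      by (simp add: vector_sadd_rdistrib add.assoc)
    hence "(?h has_field_derivative f' (axis i 1)) (at u)"
      using DERIV_shift[of ?h "f' (axis i 1)" 0 u] by (simp add: add.commute)
    thus ?thesis ..
  qed
  have hol: "?h holomorphic_on cball 0 r"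
    unfolding holomorphic_on_def field_differentiable_def using dh
    by (meson has_field_derivative_at_within)
  have "contour_integral (circlepath 0 r) (\<lambda>u. ?h u / (u-0)^2) = (2 * pi * \<i>) * deriv ?h 0"
    by (rule Cauchy_contour_integral_circlepath_2)
       (use hol r in \<open>auto intro: holomorphic_on_imp_continuous_on holomorphic_on_subset\<close>)
  hence "(2 * pi * \<i>) * pderiv_at i f x = contour_integral (circlepath 0 r) (\<lambda>u. ?h u / u^2)"
    by (simp add: pderiv_at_def)
  also have "\<dots> = integral (cbox 0 1) (\<lambda>t. ?h (circlepath 0 r t) / (circlepath 0 r t)^2 * vector_derivative (circlepath 0 r) (at t))"
    by (simp add: contour_integral_integral)
  also have "\<dots> = integral (cbox 0 1) (\<lambda>t. (2 * pi * \<i>) * (?h (circlepath 0 r t) / (circlepath 0 r t)))"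
  proof (intro arg_cong[where f="integral (cbox 0 1)"] ext)
    fix t :: real
    have "vector_derivative (circlepath 0 r) (at t) = (2 * pi * \<i>) * circlepath 0 r t"
      unfolding vector_derivative_circlepath by (simp add: circlepath)
    moreover have "circlepath 0 r t \<noteq> 0" using r by (simp add: circlepath)
    ultimately show "?h (circlepath 0 r t) / (circlepath 0 r t)^2 * vector_derivative (circlepath 0 r) (at t)
        = (2 * pi * \<i>) * (?h (circlepath 0 r t) / (circlepath 0 r t))"
      by (simp add: power2_eq_square field_simps)
  qed
  also have "\<dots> = (2 * pi * \<i>) * integral (cbox 0 1) (\<lambda>t. (?h (circlepath 0 r t) / (circlepath 0 r t)))"
    by (rule integral_mult_right)
  finally show ?thesis by simp
qed

lemma continuous_on_pderiv_at:
  fixes f :: "complex ^ 'n \<Rightarrow> complex"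
  assumes f: "holo_on f S" and S: "open S"
  shows "continuous_on S (pderiv_at i f)"
proof -
  have cf: "continuous_on S f" by (rule holo_on_imp_continuous_on[OF f])
  have "isCont (pderiv_at i f) x" if x: "x \<in> S" for x
  proof -
    obtain r where r: "r > 0" "ball x (2 * r) \<subseteq> S"
    proof -
      obtain e where "e > 0" "ball x e \<subseteq> S" using S x openE by blast
      thus ?thesis using that[of "e/2"] by simp
    qed
    define U where "U = ball x (r/2)"
    define c where "c = circlepath 0 (r/2)"
    have nc: "norm (c t) = r/2" for t using r by (simp add: c_def circlepath norm_mult)
    have nc0: "c t \<noteq> 0" for t using nc[of t] r by auto
    have cc: "continuous_on X c" for X
      unfolding c_def circlepath by (intro continuous_intros)
    have inS: "y + c t *s axis i 1 \<in> S" if "y \<in> U" for y t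
    proof -
    have "norm (c t *s axis i (1::complex)) = r/2" by (simp add: norm_smult_axis nc)
      hence "dist y (y + c t *s axis i 1) = r/2" by (simp add: dist_norm)
      moreover have "dist x y < r/2" using that by (simp add: U_def)
      ultimately have "dist x (y + c t *s axis i 1) < 2 * r"
        using dist_triangle[of x "y + c t *s axis i 1" y] r by simp
      thus ?thesis using r by auto
    qed
    have c1: "continuous_on (U \<times> cbox 0 1) (\<lambda>(y,t). f (y + c t *s axis i 1) / c t)"
      unfolding split_beta
    proof (intro continuous_intros continuous_on_compose2[OF cf])
      show "continuous_on (U \<times> cbox 0 1) (\<lambda>p. c (snd p) *s axis i 1)"
        by (rule bounded_linear.continuous_on[OF bl_smult_axis]) 
           (intro continuous_on_compose2[OF cc[of UNIV]] continuous_intros, auto)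
      show "continuous_on (U \<times> cbox 0 1) (\<lambda>p. c (snd p))"
        by (intro continuous_on_compose2[OF cc[of UNIV]] continuous_intros) auto
    qed (use inS nc0 in auto)
    have "continuous_on U (\<lambda>y. integral (cbox 0 1) (\<lambda>t. f (y + c t *s axis i 1) / c t))"
      by (rule integral_continuous_on_param[OF c1])
    moreover have "pderiv_at i f y = integral (cbox 0 1) (\<lambda>t. f (y + c t *s axis i 1) / c t)" if "y \<in> U" for y
      unfolding c_def
    proof (rule pderiv_at_integral[OF f])
      show "cball y (r/2) \<subseteq> S"
      proof
        fix z assume "z \<in> cball y (r/2)"
        hence "dist x z < 2 * r" using dist_triangle[of x z y] that r by (simp add: U_def)
        thus "z \<in> S" using r by auto
      qed
    qed (use r in auto)
    ultimately have "continuous_on U (pderiv_at i f)" by (metis (no_types, lifting) continuous_on_cong)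
    thus ?thesis using r by (auto simp: U_def continuous_on_eq_continuous_at)
  qed
  thus ?thesis using S continuous_on_eq_continuous_at by blast
qed

lemma holo_on_pderiv_at:
  fixes f :: "complex ^ 'n \<Rightarrow> complex"
  assumes f: "holo_on f S" and S: "open S"
  shows "holo_on (pderiv_at i f) S"
  unfolding holo_on_def
proof
  fix x assume x: "x \<in> S"
  define N where "N = (\<lambda>j. Blinfun (\<lambda>v::complex^'n. v $ j))"
  have N: "blinfun_apply (N j) v = v $ j" for j v
    unfolding N_def by (subst bounded_linear_Blinfun_apply) (auto intro: bounded_linear_vec_nth)
  define Df where "Df = (\<lambda>y. \<Sum>j\<in>UNIV. blinfun_mult_left (pderiv_at j f y) o\<^sub>L N j)"
  have Dfa: "blinfun_apply (Df y) v = (\<Sum>j\<in>UNIV. v $ j * pderiv_at j f y)" for y v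
    by (simp add: Df_def blinfun.sum_left N)
  have Df: "(f has_derivative blinfun_apply (Df y)) (at y)" if y: "y \<in> S" for y
  proof -
    obtain f' where f': "(f has_derivative f') (at y)" "\<And>c v. f' (c *s v) = c * f' v"
      using f y unfolding holo_on_def by blast
    have "f' = blinfun_apply (Df y)" using holo_on_deriv_sum(3)[OF f'] Dfa by auto
    thus ?thesis using f' by simp
  qed
  have cDf: "continuous_on S Df"
    unfolding Df_def
    by (intro continuous_intros bounded_linear.continuous_on[OF bounded_linear_blinfun_mult_left]
        bounded_bilinear.continuous_on[OF bounded_bilinear_blinfun_compose] continuous_on_pderiv_at[OF f S])
  have cf: "continuous_on S f" by (rule holo_on_imp_continuous_on[OF f])
  obtain r where r: "r > 0" "ball x (2 * r) \<subseteq> S"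
  proof -
    obtain e where "e > 0" "ball x e \<subseteq> S" using S x openE by blast
    thus ?thesis using that[of "e/2"] by simp
  qed
  define U where "U = ball x (r/2)"
  define c where "c = circlepath 0 (r/2)"
  have nc: "norm (c t) = r/2" for t using r by (simp add: c_def circlepath norm_mult)
  have nc0: "c t \<noteq> 0" for t using nc[of t] r by auto
  have cc: "continuous_on X c" for X
    unfolding c_def circlepath by (intro continuous_intros)
  have inS: "y + c t *s axis i 1 \<in> S" if "y \<in> U" for y t
  proof -
    have "norm (c t *s axis i (1::complex)) = r/2" by (simp add: norm_smult_axis nc)
    hence "dist y (y + c t *s axis i 1) = r/2" by (simp add: dist_norm)
    moreover have "dist x y < r/2" using that by (simp add: U_def)
    ultimately have "dist x (y + c t *s axis i 1) < 2 * r"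
      using dist_triangle[of x "y + c t *s axis i 1" y] r by simp
    thus ?thesis using r by auto
  qed
  have cpath: "continuous_on X (\<lambda>t. c t *s axis i 1)" for X
    by (rule bounded_linear.continuous_on[OF bl_smult_axis cc])
  define G where "G = (\<lambda>y t. blinfun_mult_left (1 / c t) o\<^sub>L Df (y + c t *s axis i 1))"
  have Ga: "blinfun_apply (G y t) v = blinfun_apply (Df (y + c t *s axis i 1)) v / c t" for y t v
    by (simp add: G_def)
  have der: "((\<lambda>y. f (y + c t *s axis i 1) / c t) has_derivative blinfun_apply (G y t)) (at y within U)"
    if y: "y \<in> U" for y t
  proof -
    have "((\<lambda>y. y + c t *s axis i 1) has_derivative (\<lambda>v. v)) (at y within U)"
      by (rule has_derivative_eq_rhs[OF has_derivative_add[OF has_derivative_ident has_derivative_const]]) simp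
    hence "((\<lambda>y. f (y + c t *s axis i 1)) has_derivative blinfun_apply (Df (y + c t *s axis i 1))) (at y within U)"
      by (rule has_derivative_compose[where f="\<lambda>y. y + c t *s axis i 1" and g=f
            and g'="blinfun_apply (Df (y + c t *s axis i 1))"]) (rule Df[OF inS[OF y]])
    hence "((\<lambda>y. f (y + c t *s axis i 1) * (1 / c t)) has_derivative (\<lambda>v. blinfun_apply (Df (y + c t *s axis i 1)) v * (1 / c t))) (at y within U)"
      by (rule has_derivative_mult_left)
    thus ?thesis by (simp add: Ga[abs_def])
  qed
  have contarg: "continuous_on (U \<times> cbox 0 1) (\<lambda>p. fst p + c (snd p) *s axis i 1)"
    by (intro continuous_intros continuous_on_compose2[OF cpath[of UNIV]]) auto
  have cG: "continuous_on (U \<times> cbox 0 1) (\<lambda>(y, t). G y t)"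
    unfolding split_beta G_def
  proof (intro bounded_bilinear.continuous_on[OF bounded_bilinear_blinfun_compose]
        bounded_linear.continuous_on[OF bounded_linear_blinfun_mult_left] continuous_on_compose2[OF cDf contarg])
    show "continuous_on (U \<times> cbox 0 1) (\<lambda>p. 1 / c (snd p))"
      by (intro continuous_intros continuous_on_compose2[OF cc[of UNIV]]) (use nc0 in auto)
  qed (use inS in auto)
  have int: "(\<lambda>t. f (y + c t *s axis i 1) / c t) integrable_on cbox 0 1" if "y \<in> U" for y
    by (intro integrable_continuous continuous_intros continuous_on_compose2[OF cf] cpath cc)
       (use inS that nc0 in auto)
  have xU: "x \<in> U" using r by (simp add: U_def)
  have L: "((\<lambda>y. integral (cbox 0 1) (\<lambda>t. f (y + c t *s axis i 1) / c t))
      has_derivative blinfun_apply (integral (cbox 0 1) (G x))) (at x within U)"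
    by (rule leibniz_rule[OF der int cG xU]) (auto simp: U_def)
  have eq: "pderiv_at i f y = integral (cbox 0 1) (\<lambda>t. f (y + c t *s axis i 1) / c t)" if "y \<in> U" for y
    unfolding c_def
  proof (rule pderiv_at_integral[OF f])
    show "cball y (r/2) \<subseteq> S"
    proof
      fix z assume "z \<in> cball y (r/2)"
      hence "dist x z < 2 * r" using dist_triangle[of x z y] that r by (simp add: U_def)
      thus "z \<in> S" using r by auto
    qed
  qed (use r in auto)
  have "(pderiv_at i f has_derivative blinfun_apply (integral (cbox 0 1) (G x))) (at x within U)"
    by (rule has_derivative_transform[OF xU _ L]) (simp add: eq)
  hence D: "(pderiv_at i f has_derivative blinfun_apply (integral (cbox 0 1) (G x))) (at x)"
    using xU by (metis U_def at_within_open open_ball)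
  have iG: "G x integrable_on cbox 0 1"
  proof (rule integrable_continuous)
    have "continuous_on (cbox 0 1) (\<lambda>t::real. (x, t))" by (intro continuous_intros)
    moreover have "(\<lambda>t. (x, t)) ` cbox 0 1 \<subseteq> U \<times> cbox 0 (1::real)" using xU by auto
    ultimately show "continuous_on (cbox 0 1) (G x)"
      using continuous_on_compose2[OF cG, of "cbox 0 1" "\<lambda>t. (x,t)"] by simp
  qed
  have "blinfun_apply (integral (cbox 0 1) (G x)) (k *s v) = k * blinfun_apply (integral (cbox 0 1) (G x)) v" for k v
  proof -
    have "blinfun_apply (G x t) (k *s v) = k * blinfun_apply (G x t) v" for t
      by (simp add: Ga Dfa sum_distrib_left mult.assoc)
    thus ?thesis using iG by (simp add: blinfun_apply_integral)
  qed
  with D show "\<exists>f'. (pderiv_at i f has_derivative f') (at x) \<and> (\<forall>c v. f' (c *s v) = c * f' v)"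
    by blast
qed

text \<open>Identities between meromorphic functions are identities on a dense open set; the (arbitrary)
  values of the representing total functions elsewhere are irrelevant.\<close>

definition generically :: "('a::topological_space \<Rightarrow> bool) \<Rightarrow> bool" where
  "generically P \<longleftrightarrow> (\<exists>D. open D \<and> closure D = UNIV \<and> (\<forall>x\<in>D. P x))"

text \<open>Locally a quotient of holomorphic functions whose denominator does not vanish identically
  on any nonempty open set.\<close>

definition mero_fun :: "(complex ^ 'n \<Rightarrow> complex) \<Rightarrow> bool" where
  "mero_fun f \<longleftrightarrow> (\<forall>x. \<exists>N p q. open N \<and> x \<in> N \<and> holo_on p N \<and> holo_on q N \<and>
     N \<subseteq> closure {y\<in>N. q y \<noteq> 0} \<and> (\<forall>y\<in>N. q y \<noteq> 0 \<longrightarrow> f y = p y / q y))"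

lemma dense_open_Int:
  fixes A B :: "'a::topological_space set"
  assumes "open A" "open N" "N \<subseteq> closure A" "N \<subseteq> closure B"
  shows "N \<subseteq> closure (A \<inter> B)"
proof
  fix x assume x: "x \<in> N"
  show "x \<in> closure (A \<inter> B)"
  proof (rule ccontr)
    assume nx: "x \<notin> closure (A \<inter> B)"
    define T where "T = N - closure (A \<inter> B)"
    have T: "open T" using assms by (auto simp: T_def)
    have "x \<in> T" "x \<in> closure A" using x nx assms by (auto simp: T_def)
    hence "T \<inter> A \<noteq> {}" using open_Int_closure_eq_empty[OF T, of A] by blast
    then obtain y where y: "y \<in> T \<inter> A" by blast
    hence "y \<in> closure B" using assms by (auto simp: T_def)
    moreover have "open (T \<inter> A)" using T assms by auto
    ultimately have "T \<inter> A \<inter> B \<noteq> {}" using y open_Int_closure_eq_empty[of "T \<inter> A" B] by blast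
    then obtain z where "z \<in> T" "z \<in> A \<inter> B" by blast
    thus False using closure_subset[of "A \<inter> B"] unfolding T_def by blast
  qed
qed

lemma generically_conj: "generically P \<Longrightarrow> generically Q \<Longrightarrow> generically (\<lambda>x. P x \<and> Q x)"
  unfolding generically_def
proof (elim exE conjE)
  fix D E assume "open D" "closure D = UNIV" "\<forall>x\<in>D. P x" "open E" "closure E = UNIV" "\<forall>x\<in>E. Q x"
  thus "\<exists>D. open D \<and> closure D = UNIV \<and> (\<forall>x\<in>D. P x \<and> Q x)"
    using dense_open_Int[of D UNIV E, OF _ open_UNIV] by (intro exI[of _ "D \<inter> E"]) auto
qed

lemma generically_mono: "generically P \<Longrightarrow> (\<And>x. P x \<Longrightarrow> Q x) \<Longrightarrow> generically Q"
  unfolding generically_def by blast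

lemma generically_UNIV: "(\<And>x. P x) \<Longrightarrow> generically P"
  unfolding generically_def by (intro exI[of _ UNIV]) auto

lemma holo_on_subset: "holo_on f S \<Longrightarrow> T \<subseteq> S \<Longrightarrow> holo_on f T"
  unfolding holo_on_def by blast

lemma holo_on_const: "holo_on (\<lambda>x. c) S"
  unfolding holo_on_def by (intro ballI exI[of _ "\<lambda>_. 0"]) auto

lemma holo_on_add: "holo_on f S \<Longrightarrow> holo_on g S \<Longrightarrow> holo_on (\<lambda>x. f x + g x) S"
  unfolding holo_on_def
  apply (intro ballI)
  subgoal for x
    apply (drule bspec, assumption)+
    apply (elim exE conjE)
    subgoal for f' g' by (rule exI[of _ "\<lambda>v. f' v + g' v"]) (auto intro: has_derivative_add simp: algebra_simps)
    done
  done

lemma holo_on_mult: "holo_on f S \<Longrightarrow> holo_on g S \<Longrightarrow> holo_on (\<lambda>x. f x * g x) S"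
  unfolding holo_on_def
  apply (intro ballI)
  subgoal for x
    apply (drule bspec, assumption)+
    apply (elim exE conjE)
    subgoal for f' g' by (rule exI[of _ "\<lambda>v. f x * g' v + f' v * g x"]) (auto intro: has_derivative_mult simp: algebra_simps)
    done
  done

lemma holo_on_inverse:
  assumes "holo_on f S" "\<And>x. x \<in> S \<Longrightarrow> f x \<noteq> 0"
  shows "holo_on (\<lambda>x. inverse (f x)) S"
  unfolding holo_on_def
proof
  fix x assume x: "x \<in> S"
  obtain f' where f': "(f has_derivative f') (at x)" "\<And>c v. f' (c *s v) = c * f' v"
    using assms x unfolding holo_on_def by blast
  have "((\<lambda>x. inverse (f x)) has_derivative (\<lambda>v. - (inverse (f x) * f' v * inverse (f x)))) (at x)"
    by (rule Deriv.has_derivative_inverse) (use f' assms x in auto)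
  moreover have "- (inverse (f x) * f' (c *s v) * inverse (f x)) = c * - (inverse (f x) * f' v * inverse (f x))" for c v
    by (simp add: f'(2))
  ultimately show "\<exists>f'. ((\<lambda>x. inverse (f x)) has_derivative f') (at x) \<and> (\<forall>c v. f' (c *s v) = c * f' v)"
    by blast
qed

lemma holo_on_divide:
  assumes "holo_on f S" "holo_on g S" "\<And>x. x \<in> S \<Longrightarrow> g x \<noteq> 0"
  shows "holo_on (\<lambda>x. f x / g x) S"
  using holo_on_mult[OF assms(1) holo_on_inverse[OF assms(2,3)]] by (simp add: divide_inverse)

lemma holo_on_cong:
  assumes "open S" "\<And>y. y \<in> S \<Longrightarrow> f y = g y" "holo_on f S"
  shows "holo_on g S"
  unfolding holo_on_def
proof
  fix x assume x: "x \<in> S"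
  obtain f' where "(f has_derivative f') (at x)" "\<forall>c v. f' (c *s v) = c * f' v"
    using assms(3) x unfolding holo_on_def by blast
  thus "\<exists>f'. (g has_derivative f') (at x) \<and> (\<forall>c v. f' (c *s v) = c * f' v)"
    using has_derivative_transform_within_open[of f _ x UNIV S g] assms(1,2) x by blast
qed

lemma open_nonzero: 
  assumes "open N" "holo_on q N" shows "open {y\<in>N. q y \<noteq> 0}"
proof -
  have "open (N \<inter> q -` (- {0}))"
    using continuous_open_preimage[OF holo_on_imp_continuous_on[OF assms(2)] assms(1), of "- {0}"] by auto
  moreover have "N \<inter> q -` (- {0}) = {y\<in>N. q y \<noteq> 0}" by auto
  ultimately show ?thesis by simp
qed

lemma mero_funE:
  assumes "mero_fun f"
  obtains N p q where "open N" "x \<in> N" "holo_on p N" "holo_on q N" "N \<subseteq> closure {y\<in>N. q y \<noteq> 0}"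
        "\<forall>y\<in>N. q y \<noteq> 0 \<longrightarrow> f y = p y / q y"
proof -
  from assms have "\<exists>N p q. open N \<and> x \<in> N \<and> holo_on p N \<and> holo_on q N \<and>
     N \<subseteq> closure {y\<in>N. q y \<noteq> 0} \<and> (\<forall>y\<in>N. q y \<noteq> 0 \<longrightarrow> f y = p y / q y)"
    unfolding mero_fun_def by (rule spec)
  thus ?thesis by (elim exE conjE) (rule that)
qed

lemma mero_fun_holo:
  fixes f :: "complex ^ 'n \<Rightarrow> complex"
  assumes "mero_fun f"
  obtains D where "open D" "closure D = UNIV" "holo_on f D"
proof -
  define D where "D = \<Union>{E. open E \<and> holo_on f E}"
  have o: "open D" unfolding D_def by (rule open_Union) simp
  have "x \<in> closure D" for x
  proof -
    obtain N p q where N: "open N" "x \<in> N" "holo_on p N" "holo_on q N" "N \<subseteq> closure {y\<in>N. q y \<noteq> 0}"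
      "\<forall>y\<in>N. q y \<noteq> 0 \<longrightarrow> f y = p y / q y" by (rule mero_funE[OF assms, where x=x])
    let ?E = "{y\<in>N. q y \<noteq> 0}"
    have o: "open ?E" by (rule open_nonzero[OF N(1,4)])
    have "holo_on (\<lambda>y. p y / q y) ?E"
      by (rule holo_on_divide[OF holo_on_subset[OF N(3)] holo_on_subset[OF N(4)]]) auto
    hence "holo_on f ?E" by (rule holo_on_cong[OF o, rotated]) (use N(6) in auto)
    hence "?E \<subseteq> D" using o unfolding D_def by (intro Union_upper) simp
    hence "closure ?E \<subseteq> closure D" by (rule closure_mono)
    thus ?thesis using N(2,5) by (meson subsetD)
  qed
  hence c: "closure D = UNIV" by (simp add: set_eq_iff)
  have h: "holo_on f D" unfolding D_def by (auto simp: holo_on_def)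
  show ?thesis by (rule that[OF o c h])
qed

lemma mero_funI2:
  assumes "\<And>x. \<exists>N p q. open N \<and> x \<in> N \<and> holo_on p N \<and> holo_on q N \<and>
     N \<subseteq> closure {y\<in>N. q y \<noteq> 0} \<and> (\<forall>y\<in>N. q y \<noteq> 0 \<longrightarrow> f y = p y / q y)"
  shows "mero_fun f"
  using assms unfolding mero_fun_def by blast

lemma mero_fun_binop:
  assumes f: "mero_fun f" and g: "mero_fun g"
    and P: "\<And>N p q p' q'. open N \<Longrightarrow> holo_on p N \<Longrightarrow> holo_on q N \<Longrightarrow> holo_on p' N \<Longrightarrow> holo_on q' N \<Longrightarrow> holo_on (P p q p' q') N"
    and h: "\<And>p q p' q' N y. open N \<Longrightarrow> y \<in> N \<Longrightarrow> holo_on p N \<Longrightarrow> holo_on q N \<Longrightarrow> holo_on p' N \<Longrightarrow> holo_on q' N \<Longrightarrow>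
        (\<And>y. y \<in> N \<Longrightarrow> q y \<noteq> 0) \<Longrightarrow> (\<And>y. y \<in> N \<Longrightarrow> q' y \<noteq> 0) \<Longrightarrow>
        (\<And>y. y \<in> N \<Longrightarrow> f y = p y / q y) \<Longrightarrow> (\<And>y. y \<in> N \<Longrightarrow> g y = p' y / q' y) \<Longrightarrow> h y = P p q p' q' y / (q y * q' y)"
  shows "mero_fun h"
proof (rule mero_funI2)
  fix x
  obtain N p q where N: "open N" "x \<in> N" "holo_on p N" "holo_on q N" "N \<subseteq> closure {y\<in>N. q y \<noteq> 0}"
    "\<forall>y\<in>N. q y \<noteq> 0 \<longrightarrow> f y = p y / q y" by (rule mero_funE[OF f, where x=x])
  obtain N' p' q' where N': "open N'" "x \<in> N'" "holo_on p' N'" "holo_on q' N'" "N' \<subseteq> closure {y\<in>N'. q' y \<noteq> 0}"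
    "\<forall>y\<in>N'. q' y \<noteq> 0 \<longrightarrow> g y = p' y / q' y" by (rule mero_funE[OF g, where x=x])
  let ?M = "N \<inter> N'"
  let ?E = "{y\<in>N. q y \<noteq> 0} \<inter> {y\<in>N'. q' y \<noteq> 0}"
  have hol: "holo_on p ?M" "holo_on q ?M" "holo_on p' ?M" "holo_on q' ?M"
    using holo_on_subset[OF N(3), of ?M] holo_on_subset[OF N(4), of ?M] holo_on_subset[OF N'(3), of ?M] holo_on_subset[OF N'(4), of ?M] by blast+
  have "open ?M" by (rule open_Int[OF N(1) N'(1)])
  have oE: "open ?E" by (rule open_Int[OF open_nonzero[OF N(1,4)] open_nonzero[OF N'(1,4)]])
  have E: "?E = {y \<in> ?M. q y * q' y \<noteq> 0}" by auto
  have "?M \<subseteq> closure {y\<in>N. q y \<noteq> 0}" by (rule subset_trans[OF Int_lower1 N(5)])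
  moreover have "?M \<subseteq> closure {y\<in>N'. q' y \<noteq> 0}" by (rule subset_trans[OF Int_lower2 N'(5)])
  ultimately have "?M \<subseteq> closure ?E"
    by (rule dense_open_Int[OF open_nonzero[OF N(1,4)] \<open>open ?M\<close>])
  moreover have "h y = P p q p' q' y / (q y * q' y)" if "y \<in> ?E" for y
  proof (rule h[OF oE that])
    show "holo_on p ?E" by (rule holo_on_subset[OF N(3)]) auto
    show "holo_on q ?E" by (rule holo_on_subset[OF N(4)]) auto
    show "holo_on p' ?E" by (rule holo_on_subset[OF N'(3)]) auto
    show "holo_on q' ?E" by (rule holo_on_subset[OF N'(4)]) auto
  qed (use N(6) N'(6) in auto)
  ultimately show "\<exists>N p q. open N \<and> x \<in> N \<and> holo_on p N \<and> holo_on q N \<and>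
     N \<subseteq> closure {y\<in>N. q y \<noteq> 0} \<and> (\<forall>y\<in>N. q y \<noteq> 0 \<longrightarrow> h y = p y / q y)"
    using N(2) N'(2) \<open>open ?M\<close> P[OF \<open>open ?M\<close> hol] holo_on_mult[OF hol(2,4)] unfolding E
    by (intro exI[of _ ?M] exI[of _ "P p q p' q'"] exI[of _ "\<lambda>y. q y * q' y"] conjI ballI impI IntI) simp_all
qed

lemma mero_fun_const: "mero_fun (\<lambda>x. c)"
  by (rule mero_funI2, intro exI[of _ UNIV] exI[of _ "\<lambda>_. c"] exI[of _ "\<lambda>_. 1"]) (auto simp: holo_on_const)

lemma mero_fun_add:
  assumes "mero_fun f" "mero_fun g"
  shows "mero_fun (\<lambda>x. f x + g x)"
proof (rule mero_fun_binop[OF assms, where P="\<lambda>p q p' q' x. p x * q' x + p' x * q x"])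
  fix p q p' q' N y
  assume y: "y \<in> N" and A: "\<And>y. y \<in> N \<Longrightarrow> q y \<noteq> (0::complex)" "\<And>y. y \<in> N \<Longrightarrow> q' y \<noteq> (0::complex)"
    "\<And>y. y \<in> N \<Longrightarrow> f y = p y / q y" "\<And>y. y \<in> N \<Longrightarrow> g y = p' y / q' y"
  show "f y + g y = (p y * q' y + p' y * q y) / (q y * q' y)" using A(1,2)[OF y] by (simp add: A(3,4)[OF y] field_simps)
qed (intro holo_on_add holo_on_mult; assumption)

lemma mero_fun_mult:
  assumes "mero_fun f" "mero_fun g"
  shows "mero_fun (\<lambda>x. f x * g x)"
proof (rule mero_fun_binop[OF assms, where P="\<lambda>p q p' q' x. p x * p' x"])
  fix p q p' q' N y
  assume y: "y \<in> N" and A: "\<And>y. y \<in> N \<Longrightarrow> q y \<noteq> (0::complex)" "\<And>y. y \<in> N \<Longrightarrow> q' y \<noteq> (0::complex)"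
    "\<And>y. y \<in> N \<Longrightarrow> f y = p y / q y" "\<And>y. y \<in> N \<Longrightarrow> g y = p' y / q' y"
  show "f y * g y = (p y * p' y) / (q y * q' y)" using A(1,2)[OF y] by (simp add: A(3,4)[OF y] field_simps)
qed (intro holo_on_mult; assumption)

lemma mero_fun_uminus: "mero_fun f \<Longrightarrow> mero_fun (\<lambda>x. - f x)"
  using mero_fun_mult[OF mero_fun_const[of "-1"]] by simp

lemma pderiv_at_cong:
  assumes "open D" "x \<in> D" "\<And>y. y \<in> D \<Longrightarrow> f y = g y"
  shows "pderiv_at i f x = pderiv_at i g x"
proof -
  have c: "continuous (at 0) (\<lambda>t. x + t *s axis i 1)"
    by (intro continuous_intros linear_continuous_at bounded_linear.isCont[OF bl_smult_axis])
  have "eventually (\<lambda>t. x + t *s axis i 1 \<in> D) (nhds (0::complex))"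
    using c assms(1,2) unfolding continuous_within tendsto_def
    by (simp add: eventually_nhds_conv_at)
  hence "eventually (\<lambda>t. f (x + t *s axis i 1) = g (x + t *s axis i 1)) (nhds 0)"
    by eventually_elim (use assms in auto)
  thus ?thesis unfolding pderiv_at_def by (rule deriv_cong_ev) simp
qed

lemma pderiv_at_quotient:
  assumes N: "open N" and y: "y \<in> N" and p: "holo_on p N" and q: "holo_on q N" and nz: "\<And>y. y \<in> N \<Longrightarrow> q y \<noteq> 0"
    and f: "\<And>y. y \<in> N \<Longrightarrow> f y = p y / q y"
  shows "pderiv_at i f y = (pderiv_at i p y * q y - p y * pderiv_at i q y) / (q y * q y)"
proof -
  obtain p' where p': "(p has_derivative p') (at y)" "\<And>c v. p' (c *s v) = c * p' v"
    using p y unfolding holo_on_def by blast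
  obtain q' where q': "(q has_derivative q') (at y)" "\<And>c v. q' (c *s v) = c * q' v"
    using q y unfolding holo_on_def by blast
  have dp: "((\<lambda>t. p (y + t *s axis i 1)) has_field_derivative p' (axis i 1)) (at 0)" "pderiv_at i p y = p' (axis i 1)"
    by (rule holo_on_deriv_sum[OF p'])+
  have dq: "((\<lambda>t. q (y + t *s axis i 1)) has_field_derivative q' (axis i 1)) (at 0)" "pderiv_at i q y = q' (axis i 1)"
    by (rule holo_on_deriv_sum[OF q'])+
  have "((\<lambda>t. p (y + t *s axis i 1) / q (y + t *s axis i 1)) has_field_derivative
     (p' (axis i 1) * q y - p y * q' (axis i 1)) / (q y * q y)) (at 0)"
    using DERIV_divide[OF dp(1) dq(1)] nz[OF y] by simp
  hence "pderiv_at i (\<lambda>y. p y / q y) y = (p' (axis i 1) * q y - p y * q' (axis i 1)) / (q y * q y)"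
    unfolding pderiv_at_def by (rule DERIV_imp_deriv)
  thus ?thesis using pderiv_at_cong[OF N y f, where i=i] dp(2) dq(2) by simp
qed


lemma mero_fun_pderiv: 
  fixes f :: "complex ^ 'n \<Rightarrow> complex"
  assumes "mero_fun f" shows "mero_fun (pderiv_at i f)"
proof (rule mero_funI2)
  fix x
  obtain N p q where N: "open N" "x \<in> N" "holo_on p N" "holo_on q N" "N \<subseteq> closure {y\<in>N. q y \<noteq> 0}"
    "\<forall>y\<in>N. q y \<noteq> 0 \<longrightarrow> f y = p y / q y" by (rule mero_funE[OF assms, where x=x])
  let ?E = "{y\<in>N. q y \<noteq> 0}"
  let ?P = "\<lambda>y. pderiv_at i p y * q y + (-1) * (p y * pderiv_at i q y)"
  have "holo_on ?P N"
    by (intro holo_on_add holo_on_mult holo_on_const holo_on_pderiv_at N)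
  moreover have "pderiv_at i f y = ?P y / (q y * q y)" if "y \<in> ?E" for y
  proof -
    have "pderiv_at i f y = (pderiv_at i p y * q y - p y * pderiv_at i q y) / (q y * q y)"
      by (rule pderiv_at_quotient[OF open_nonzero[OF N(1,4)] that holo_on_subset[OF N(3)] holo_on_subset[OF N(4)]])
         (use N(6) in auto)
    thus ?thesis by simp
  qed
  ultimately show "\<exists>N p q. open N \<and> x \<in> N \<and> holo_on p N \<and> holo_on q N \<and>
     N \<subseteq> closure {y\<in>N. q y \<noteq> 0} \<and> (\<forall>y\<in>N. q y \<noteq> 0 \<longrightarrow> pderiv_at i f y = p y / q y)"
    using N(1,2,5) holo_on_mult[OF N(4,4)]
    by (intro exI[of _ N] exI[of _ ?P] exI[of _ "\<lambda>y. q y * q y"] conjI ballI impI) simp_all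
qed

text \<open>The permutation action: $w$ sends the basis vector $e_i$ to $e_{w(i)}$.\<close>

definition perm_vec :: "'n perm \<Rightarrow> 'a ^ 'n \<Rightarrow> 'a ^ 'n" where
  "perm_vec w v = (\<chi> i. v $ (inverse w \<langle>$\<rangle> i))"

lemma perm_vec_mult: "perm_vec (u * w) v = perm_vec u (perm_vec w v)"
  by (simp add: perm_vec_def vec_eq_iff apply_times)

lemma perm_vec_1: "perm_vec 1 v = v"
  by (simp add: perm_vec_def vec_eq_iff)

lemma apply_inverse_apply [simp]:
  "inverse w \<langle>$\<rangle> (w \<langle>$\<rangle> i) = i" "w \<langle>$\<rangle> (inverse w \<langle>$\<rangle> i) = i"
  by (simp_all add: apply_sequence)

lemma perm_vec_axis: "perm_vec w (axis i a) = axis (w \<langle>$\<rangle> i) a"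
proof -
  have "(inverse w \<langle>$\<rangle> j = i) = (j = w \<langle>$\<rangle> i)" for j
    by auto
  thus ?thesis by (simp add: perm_vec_def vec_eq_iff axis_def)
qed

lemma perm_vec_linear: "perm_vec w (x + c *s y) = perm_vec w x + c *s perm_vec w y" for c :: complex
  by (simp add: perm_vec_def vec_eq_iff)

lemma perm_vec_smult: "perm_vec w (c *s y) = c *s perm_vec w y" for c :: complex
  by (simp add: perm_vec_def vec_eq_iff)

lemma bl_perm_vec: "bounded_linear (perm_vec w :: complex ^ 'n \<Rightarrow> complex ^ 'n)"
proof -
  have "linear (perm_vec w :: complex ^ 'n \<Rightarrow> complex ^ 'n)"
    by (rule linearI) (auto simp: vec_eq_iff perm_vec_def)
  thus ?thesis by (simp add: linear_conv_bounded_linear)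
qed

lemma perm_vec_inv [simp]: "perm_vec w (perm_vec (inverse w) v) = v" "perm_vec (inverse w) (perm_vec w v) = v"
  by (simp_all add: perm_vec_def vec_eq_iff)

lemma perm_vec_vimage: "perm_vec w -` S = perm_vec (inverse w) ` S"
proof (intro equalityI subsetI)
  fix x assume "x \<in> perm_vec w -` S"
  hence "perm_vec (inverse w) (perm_vec w x) \<in> perm_vec (inverse w) ` S" by (intro imageI) simp
  thus "x \<in> perm_vec (inverse w) ` S" by simp
qed auto

lemma open_perm_vec: "open S \<Longrightarrow> open (perm_vec w -` S)" for S :: "(complex ^ 'n) set"
  by (rule open_vimage) (auto intro: linear_continuous_on bl_perm_vec)

lemma closure_perm_vec: "perm_vec w -` closure S \<subseteq> closure (perm_vec w -` S)" for S :: "(complex ^ 'n) set"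
proof
  fix x assume x: "x \<in> perm_vec w -` closure S"
  have c: "continuous_on (closure S) (perm_vec (inverse w) :: complex ^ 'n \<Rightarrow> complex ^ 'n)" by (rule linear_continuous_on[OF bl_perm_vec])
  have "perm_vec (inverse w) ` closure S \<subseteq> closure (perm_vec (inverse w) ` S)"
    by (rule image_closure_subset[OF c]) (auto simp: closure_subset)
  thus "x \<in> closure (perm_vec w -` S)" using x unfolding perm_vec_vimage by blast
qed

lemma generically_perm_vec: 
  assumes "generically P" shows "generically (\<lambda>x::complex ^ 'n. P (perm_vec w x))"
proof -
  obtain D where D: "open D" "closure D = UNIV" "\<forall>x\<in>D. P x" using assms unfolding generically_def by blast
  show ?thesis unfolding generically_def
    by (rule exI[of _ "perm_vec w -` D"])
       (use D closure_perm_vec[of w D] open_perm_vec in auto)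
qed

lemma holo_on_perm_vec: 
  assumes "holo_on f S" shows "holo_on (\<lambda>x. f (perm_vec w x)) (perm_vec w -` S)"
  unfolding holo_on_def
proof
  fix x assume "x \<in> perm_vec w -` S"
  then obtain f' where f': "(f has_derivative f') (at (perm_vec w x))" "\<And>c v. f' (c *s v) = c * f' v"
    using assms unfolding holo_on_def by auto
  have "((\<lambda>x. f (perm_vec w x)) has_derivative (\<lambda>v. f' (perm_vec w v))) (at x)"
    by (rule has_derivative_compose[where f="perm_vec w" and g=f and g'=f'])
       (use f' bounded_linear_imp_has_derivative[OF bl_perm_vec] in auto)
  moreover have "f' (perm_vec w (c *s v)) = c * f' (perm_vec w v)" for c v
    by (simp only: perm_vec_smult f'(2))
  ultimately show "\<exists>f'. ((\<lambda>x. f (perm_vec w x)) has_derivative f') (at x) \<and> (\<forall>c v. f' (c *s v) = c * f' v)" by blast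
qed

lemma mero_fun_perm_vec:
  assumes "mero_fun f" shows "mero_fun (\<lambda>x. f (perm_vec w x))"
proof (rule mero_funI2)
  fix x
  obtain N p q where N: "open N" "perm_vec w x \<in> N" "holo_on p N" "holo_on q N" "N \<subseteq> closure {y\<in>N. q y \<noteq> 0}"
    "\<forall>y\<in>N. q y \<noteq> 0 \<longrightarrow> f y = p y / q y" by (rule mero_funE[OF assms, where x="perm_vec w x"])
  have "perm_vec w -` N \<subseteq> perm_vec w -` closure {y\<in>N. q y \<noteq> 0}" by (rule vimage_mono[OF N(5)])
  also have "\<dots> \<subseteq> closure (perm_vec w -` {y\<in>N. q y \<noteq> 0})" by (rule closure_perm_vec)
  also have "perm_vec w -` {y\<in>N. q y \<noteq> 0} = {y \<in> perm_vec w -` N. q (perm_vec w y) \<noteq> 0}" by auto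
  finally show "\<exists>N p q. open N \<and> x \<in> N \<and> holo_on p N \<and> holo_on q N \<and>
     N \<subseteq> closure {y\<in>N. q y \<noteq> 0} \<and> (\<forall>y\<in>N. q y \<noteq> 0 \<longrightarrow> f (perm_vec w y) = p y / q y)"
    using N(2,6)
    by (intro exI[of _ "perm_vec w -` N"] exI[of _ "\<lambda>x. p (perm_vec w x)"] exI[of _ "\<lambda>x. q (perm_vec w x)"]
         conjI ballI impI open_perm_vec[OF N(1)] holo_on_perm_vec[OF N(3)] holo_on_perm_vec[OF N(4)]) simp_all
qed

lemma pderiv_at_perm_vec:
  "pderiv_at (w \<langle>$\<rangle> i) (\<lambda>x. f (perm_vec (inverse w) x)) x = pderiv_at i f (perm_vec (inverse w) x)"
proof -
  have "perm_vec (inverse w) (x + t *s axis (w \<langle>$\<rangle> i) 1) = perm_vec (inverse w) x + t *s axis i 1" for t :: complex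
    unfolding perm_vec_linear perm_vec_axis by simp
  thus ?thesis by (simp add: pderiv_at_def)
qed

lemma pderiv_at_add:
  assumes f: "mero_fun f" and g: "mero_fun g"
  shows "generically (\<lambda>x. pderiv_at i (\<lambda>x. f x + g x) x = pderiv_at i f x + pderiv_at i g x)"
proof -
  obtain D where D: "open D" "closure D = UNIV" "holo_on f D" using mero_fun_holo[OF f] .
  obtain E where E: "open E" "closure E = UNIV" "holo_on g E" using mero_fun_holo[OF g] .
  have "generically (\<lambda>x. x \<in> D)" "generically (\<lambda>x. x \<in> E)" using D E unfolding generically_def by blast+
  hence "generically (\<lambda>x. x \<in> D \<and> x \<in> E)" by (rule generically_conj)
  thus ?thesis
  proof (rule generically_mono)
    fix x assume x: "x \<in> D \<and> x \<in> E"
    obtain f' where f': "(f has_derivative f') (at x)" "\<And>c v. f' (c *s v) = c * f' v"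
      using D x unfolding holo_on_def by blast
    obtain g' where g': "(g has_derivative g') (at x)" "\<And>c v. g' (c *s v) = c * g' v"
      using E x unfolding holo_on_def by blast
    have df: "((\<lambda>t. f (x + t *s axis i 1)) has_field_derivative f' (axis i 1)) (at 0)" "pderiv_at i f x = f' (axis i 1)"
      by (rule holo_on_deriv_sum[OF f'])+
    have dg: "((\<lambda>t. g (x + t *s axis i 1)) has_field_derivative g' (axis i 1)) (at 0)" "pderiv_at i g x = g' (axis i 1)"
      by (rule holo_on_deriv_sum[OF g'])+
    show "pderiv_at i (\<lambda>x. f x + g x) x = pderiv_at i f x + pderiv_at i g x"
      using DERIV_imp_deriv[OF DERIV_add[OF df(1) dg(1)]] df(2) dg(2) by (simp add: pderiv_at_def)
  qed
qed

lemma pderiv_at_generically_cong: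
  assumes "generically (\<lambda>x. f x = g x)" shows "generically (\<lambda>x. pderiv_at i f x = pderiv_at i g x)"
proof -
  obtain D where "open D" "closure D = UNIV" "\<forall>x\<in>D. f x = g x" using assms unfolding generically_def by blast
  thus ?thesis unfolding generically_def by (intro exI[of _ D]) (auto intro: pderiv_at_cong)
qed

lemma generically_conj_imp:
  assumes "generically P" "generically Q" "\<And>x. P x \<Longrightarrow> Q x \<Longrightarrow> R x"
  shows "generically R"
  using generically_mono[OF generically_conj[OF assms(1,2)], of R] assms(3) by blast

text \<open>The ring $\mathbb{C}(V)$ of meromorphic functions on $V = \mathbb{C}^n$.\<close>

quotient_type 'n mero = "complex ^ ('n::finite) \<Rightarrow> complex" /
  partial: "\<lambda>f g. mero_fun f \<and> mero_fun g \<and> generically (\<lambda>x. f x = g x)"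
proof (rule part_equivpI)
  show "\<exists>x. mero_fun (x :: complex ^ 'n \<Rightarrow> complex) \<and> mero_fun x \<and> generically (\<lambda>y. x y = x y)"
    by (intro exI[of _ "\<lambda>_. 0"] conjI mero_fun_const generically_UNIV) simp
  show "symp (\<lambda>f g :: complex ^ 'n \<Rightarrow> complex. mero_fun f \<and> mero_fun g \<and> generically (\<lambda>x. f x = g x))"
    by (rule sympI) (simp add: eq_commute)
  show "transp (\<lambda>f g :: complex ^ 'n \<Rightarrow> complex. mero_fun f \<and> mero_fun g \<and> generically (\<lambda>x. f x = g x))"
  proof (rule transpI, elim conjE, intro conjI)
    fix x y z :: "complex ^ 'n \<Rightarrow> complex"
    assume "generically (\<lambda>a. x a = y a)" "generically (\<lambda>a. y a = z a)"
    from generically_conj_imp[OF this] show "generically (\<lambda>a. x a = z a)" by simp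
  qed assumption+
qed

instantiation mero :: (finite) comm_ring_1
begin
lift_definition zero_mero :: "'a mero" is "\<lambda>_. 0" by (intro conjI mero_fun_const generically_UNIV refl)
lift_definition one_mero :: "'a mero" is "\<lambda>_. 1" by (intro conjI mero_fun_const generically_UNIV refl)
lift_definition plus_mero :: "'a mero \<Rightarrow> 'a mero \<Rightarrow> 'a mero" is "\<lambda>f g x. f x + g x"
  by (elim conjE, intro conjI mero_fun_add; (assumption | (rule generically_conj_imp, assumption, assumption, simp)))
lift_definition times_mero :: "'a mero \<Rightarrow> 'a mero \<Rightarrow> 'a mero" is "\<lambda>f g x. f x * g x"
  by (elim conjE, intro conjI mero_fun_mult; (assumption | (rule generically_conj_imp, assumption, assumption, simp)))
lift_definition uminus_mero :: "'a mero \<Rightarrow> 'a mero" is "\<lambda>f x. - f x"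
  by (elim conjE, intro conjI mero_fun_uminus; (assumption | (erule generically_mono, simp)))
definition minus_mero :: "'a mero \<Rightarrow> 'a mero \<Rightarrow> 'a mero" where "minus_mero f g = f + - g"
instance
proof
  fix a b c :: "'a mero"
  show "a - b = a + - b" by (rule minus_mero_def)
  show "0 \<noteq> (1::'a mero)" by transfer (auto simp: generically_def)
qed (transfer; elim conjE; intro conjI mero_fun_add mero_fun_mult mero_fun_uminus mero_fun_const generically_UNIV;
     (assumption | simp add: algebra_simps))+
end

lift_definition const_mero :: "complex \<Rightarrow> 'n::finite mero" is "\<lambda>c _. c"
  by (intro conjI mero_fun_const generically_UNIV) simp

lift_definition pderiv_mero :: "'n \<Rightarrow> 'n::finite mero \<Rightarrow> 'n mero" is pderiv_at
  by (elim conjE, intro conjI mero_fun_pderiv pderiv_at_generically_cong)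

text \<open>$(w.f)(v) = f(w^{-1}.v)$\<close>

lift_definition perm_mero :: "'n perm \<Rightarrow> 'n::finite mero \<Rightarrow> 'n mero" is "\<lambda>w f x. f (perm_vec (inverse w) x)"
  by (elim conjE, intro conjI mero_fun_perm_vec, assumption, assumption, drule generically_perm_vec, assumption)

lemma pderiv_mero_add: "pderiv_mero i (f + g) = pderiv_mero i f + pderiv_mero i g"
  by (transfer, elim conjE, intro conjI mero_fun_pderiv mero_fun_add pderiv_at_add)

lemma perm_mero_mult: "perm_mero w (f * g) = perm_mero w f * perm_mero w g"
  by (transfer, elim conjE, intro conjI mero_fun_mult mero_fun_perm_vec generically_UNIV refl)

lemma perm_mero_add: "perm_mero w (f + g) = perm_mero w f + perm_mero w g"
  by (transfer, elim conjE, intro conjI mero_fun_add mero_fun_perm_vec generically_UNIV refl)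

lemma perm_mero_times: "perm_mero (u * w) f = perm_mero u (perm_mero w f)"
  by (transfer, elim conjE, intro conjI mero_fun_perm_vec generically_UNIV)
     (simp_all add: perm_vec_mult mero_fun_perm_vec)

lemma perm_mero_1: "perm_mero 1 f = f"
  by transfer (simp add: perm_vec_1)

lemma perm_mero_pderiv: "perm_mero w (pderiv_mero i f) = pderiv_mero (w \<langle>$\<rangle> i) (perm_mero w f)"
  by (transfer, elim conjE, intro conjI mero_fun_perm_vec mero_fun_pderiv generically_UNIV)
     (simp_all add: pderiv_at_perm_vec mero_fun_perm_vec)


section \<open>Differential operators and the crossed product\<close>

lifting_forget mero.lifting

text \<open>$\mathcal{D}(V)$ is the subring of the endomorphisms of $\mathbb{C}(V)$ generated by
  the multiplication operators and the partial derivatives. It is closed under negatives, and contains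
  $0$ and $1$, because of the multiplications by constants.\<close>

inductive_set diff_operators :: "('n::finite mero \<Rightarrow> 'n mero) set" where
  mult: "(\<lambda>f. a * f) \<in> diff_operators"
| pderiv: "pderiv_mero i \<in> diff_operators"
| add: "D \<in> diff_operators \<Longrightarrow> E \<in> diff_operators \<Longrightarrow> (\<lambda>f. D f + E f) \<in> diff_operators"
| comp: "D \<in> diff_operators \<Longrightarrow> E \<in> diff_operators \<Longrightarrow> (\<lambda>f. D (E f)) \<in> diff_operators"

typedef ('n::finite) diffop = "diff_operators :: ('n mero \<Rightarrow> 'n mero) set"
  by (rule exI, rule diff_operators.mult)

setup_lifting type_definition_diffop

lemma diff_operators_add: "D \<in> diff_operators \<Longrightarrow> D (f + g) = D f + D g"
  by (induction D arbitrary: f g rule: diff_operators.induct)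
     (simp_all add: pderiv_mero_add algebra_simps)

instantiation diffop :: (finite) ring_1
begin
lift_definition zero_diffop :: "'a diffop" is "\<lambda>_. 0"
  subgoal
  proof -
    have "(\<lambda>f :: 'a mero. 0 * f) \<in> diff_operators" by (rule diff_operators.mult)
    thus ?thesis by simp
  qed
  done
lift_definition one_diffop :: "'a diffop" is "\<lambda>f. f"
  subgoal
  proof -
    have "(\<lambda>f :: 'a mero. 1 * f) \<in> diff_operators" by (rule diff_operators.mult)
    thus ?thesis by simp
  qed
  done
lift_definition plus_diffop :: "'a diffop \<Rightarrow> 'a diffop \<Rightarrow> 'a diffop" is "\<lambda>D E f. D f + E f"
  by (rule diff_operators.add)
lift_definition times_diffop :: "'a diffop \<Rightarrow> 'a diffop \<Rightarrow> 'a diffop" is "\<lambda>D E f. D (E f)"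
  by (rule diff_operators.comp)
lift_definition uminus_diffop :: "'a diffop \<Rightarrow> 'a diffop" is "\<lambda>D f. - D f"
  subgoal premises D for D
  proof -
    have "(\<lambda>f. - 1 * D f) \<in> diff_operators" by (rule diff_operators.comp[OF diff_operators.mult D])
    thus ?thesis by simp
  qed
  done
definition minus_diffop :: "'a diffop \<Rightarrow> 'a diffop \<Rightarrow> 'a diffop" where "minus_diffop D E = D + - E"
instance
proof
  fix a b c :: "'a diffop"
  show "a - b = a + - b" by (rule minus_diffop_def)
  show "0 \<noteq> (1::'a diffop)" by transfer (metis zero_neq_one)
  show "a * (b + c) = a * b + a * c" by transfer (simp add: diff_operators_add)
qed (transfer; simp add: algebra_simps)+
end

lift_definition mult_op :: "'n::finite mero \<Rightarrow> 'n diffop" is "\<lambda>a f. a * f"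
  by (rule diff_operators.mult)

lift_definition pderiv_op :: "'n::finite \<Rightarrow> 'n diffop" is pderiv_mero
  by (rule diff_operators.pderiv)

lemma perm_mero_inv: "perm_mero w (perm_mero (inverse w) f) = f" "perm_mero (inverse w) (perm_mero w f) = f"
  by (simp_all add: perm_mero_1 flip: perm_mero_times)

text \<open>The action of $W$ on $\mathcal{D}(V)$ is conjugation by its action on $\mathbb{C}(V)$;
  on generators it is given by \<open>perm_diffop_mult_op\<close> and \<open>perm_diffop_pderiv_op\<close> below.\<close>

lift_definition perm_diffop :: "'n perm \<Rightarrow> 'n::finite diffop \<Rightarrow> 'n diffop" is
  "\<lambda>w D f. perm_mero w (D (perm_mero (inverse w) f))"
  subgoal premises D for w D
    using D
  proof (induction D rule: diff_operators.induct)
    case (mult a)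
    thus ?case using diff_operators.mult[of "perm_mero w a"] by (simp add: perm_mero_mult perm_mero_inv)
  next
    case (pderiv i)
    thus ?case using diff_operators.pderiv[of "w \<langle>$\<rangle> i"] by (simp add: perm_mero_pderiv perm_mero_inv)
  next
    case (add D E)
    thus ?case using diff_operators.add[OF add.IH] by (simp add: perm_mero_add)
  next
    case (comp D E)
    thus ?case using diff_operators.comp[OF comp.IH] by (simp add: perm_mero_inv)
  qed
  done

lemma perm_diffop_mult_op: "perm_diffop w (mult_op a) = mult_op (perm_mero w a)"
  by transfer (simp add: perm_mero_mult perm_mero_inv)

lemma perm_diffop_pderiv_op: "perm_diffop w (pderiv_op i) = pderiv_op (w \<langle>$\<rangle> i)"
  by transfer (simp add: perm_mero_pderiv perm_mero_inv)

lemma perm_diffop_add: "perm_diffop w (D + E) = perm_diffop w D + perm_diffop w E"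
  by transfer (simp add: perm_mero_add)

lemma perm_mero_0: "perm_mero w 0 = 0"
  using perm_mero_add[of w 0 0] by simp

lemma perm_diffop_0: "perm_diffop w 0 = 0"
  by transfer (simp add: perm_mero_0)

lemma perm_diffop_sum: "perm_diffop w (sum D A) = (\<Sum>x\<in>A. perm_diffop w (D x))"
  by (induction A rule: infinite_finite_induct) (simp_all add: perm_diffop_0 perm_diffop_add)

lemma perm_diffop_mult: "perm_diffop w (D * E) = perm_diffop w D * perm_diffop w E"
  by transfer (simp add: perm_mero_inv)

lemma perm_diffop_one: "perm_diffop w 1 = 1"
  by transfer (simp add: perm_mero_inv)

lemma perm_diffop_times: "perm_diffop (u * w) D = perm_diffop u (perm_diffop w D)"
  by transfer (simp add: perm_mero_times)

lemma perm_diffop_1: "perm_diffop 1 D = D"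
  by transfer (simp add: perm_mero_1 perm.inverse_neutral)

instance perm :: (finite) finite
proof
  have "inj (Perm.apply :: 'a perm \<Rightarrow> _)" by (simp add: inj_on_def apply_inject)
  moreover have "finite (range (Perm.apply :: 'a perm \<Rightarrow> _))" by (rule finite)
  ultimately show "finite (UNIV :: 'a perm set)" using finite_imageD by blast
qed

text \<open>The standard basis of $U = (\mathbb{C}^d)^{\otimes n}$ is indexed by functions
  \<open>'n \<Rightarrow> 'd\<close>, and $\mathcal{D}(V) \otimes \mathrm{End}\,U$ is the ring of matrices over
  $\mathcal{D}(V)$ with rows and columns indexed by this basis.\<close>

type_synonym ('n, 'd) diffop_matrix = "'n diffop ^ ('n \<Rightarrow> 'd) ^ ('n \<Rightarrow> 'd)"

text \<open>The operator on $U$ moving the tensor factor in position $k$ to position $w(k)$, so the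
  basis vector $q$ goes to $q \circ w^{-1}$.\<close>

definition perm_matrix :: "'n::finite perm \<Rightarrow> 'a::{zero,one} ^ ('n \<Rightarrow> 'd::finite) ^ ('n \<Rightarrow> 'd)" where
  "perm_matrix w = (\<chi> p q. if p = (\<lambda>k. q (inverse w \<langle>$\<rangle> k)) then 1 else 0)"

text \<open>$\widehat w.(a \otimes b) = (w.a) \otimes (w b w^{-1})$\<close>

definition hat_action :: "'n perm \<Rightarrow> ('n::finite, 'd::finite) diffop_matrix \<Rightarrow> ('n, 'd) diffop_matrix" where
  "hat_action w A = perm_matrix w ** (\<chi> p q. perm_diffop w (A $ p $ q)) ** perm_matrix (inverse w)"

lemma hat_action_entry:
  fixes A :: "('n::finite, 'd::finite) diffop_matrix"
  shows "hat_action w A $ p $ q = perm_diffop w (A $ (\<lambda>k. p (w \<langle>$\<rangle> k)) $ (\<lambda>k. q (w \<langle>$\<rangle> k)))"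
proof -
  have 1: "(p = (\<lambda>k. r (inverse w \<langle>$\<rangle> k))) = (r = (\<lambda>k. p (w \<langle>$\<rangle> k)))" for p r :: "'n \<Rightarrow> 'd"
    by auto
  have 2: "(r = (\<lambda>k. q (inverse (inverse w) \<langle>$\<rangle> k))) = (r = (\<lambda>k. q (w \<langle>$\<rangle> k)))" for q r :: "'n \<Rightarrow> 'd"
    by simp
  show ?thesis
    unfolding hat_action_def perm_matrix_def matrix_matrix_mult_def
    by (simp add: 1 2 if_distrib[of "\<lambda>x. x * _"] if_distrib[of "\<lambda>x. _ * x"] cong: if_cong)
qed

lemma hat_action_add:
  fixes A :: "('n::finite, 'd::finite) diffop_matrix"
  shows "hat_action w (A + B) = hat_action w A + hat_action w B"
  by (simp add: vec_eq_iff hat_action_entry perm_diffop_add)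

lemma hat_action_0: "hat_action w (0 :: ('n::finite, 'd::finite) diffop_matrix) = 0"
  by (simp add: vec_eq_iff hat_action_entry perm_diffop_0)

lemma hat_action_sum:
  fixes A :: "'i \<Rightarrow> ('n::finite, 'd::finite) diffop_matrix"
  shows "hat_action w (sum A S) = (\<Sum>x\<in>S. hat_action w (A x))"
  by (induction S rule: infinite_finite_induct) (simp_all add: hat_action_0 hat_action_add)

lemma hat_action_times:
  fixes A :: "('n::finite, 'd::finite) diffop_matrix"
  shows "hat_action (u * w) A = hat_action u (hat_action w A)"
  by (simp add: vec_eq_iff hat_action_entry perm_diffop_times apply_sequence)

lemma hat_action_1:
  fixes A :: "('n::finite, 'd::finite) diffop_matrix"
  shows "hat_action 1 A = A"
  by (simp add: vec_eq_iff hat_action_entry perm_diffop_1)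

lemma hat_action_one: "hat_action w (mat 1 :: ('n::finite, 'd::finite) diffop_matrix) = mat 1"
proof -
  have "((\<lambda>k. p (w \<langle>$\<rangle> k)) = (\<lambda>k. q (w \<langle>$\<rangle> k))) = (p = q)" for p q :: "'n \<Rightarrow> 'd"
  proof
    assume e: "(\<lambda>k. p (w \<langle>$\<rangle> k)) = (\<lambda>k. q (w \<langle>$\<rangle> k))"
    show "p = q"
    proof
      fix k show "p k = q k" using fun_cong[OF e, of "inverse w \<langle>$\<rangle> k"] by simp
    qed
  qed simp
  thus ?thesis by (simp add: vec_eq_iff hat_action_entry mat_def perm_diffop_one perm_diffop_0)
qed

lemma hat_action_mult: "hat_action w (A ** B) = hat_action w A ** hat_action w (B :: ('n::finite,'d::finite) diffop_matrix)"
proof -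
  have "(\<Sum>r\<in>UNIV. X (\<lambda>k. r (w \<langle>$\<rangle> k))) = (\<Sum>r\<in>UNIV. X r)" for X :: "('n \<Rightarrow> 'd) \<Rightarrow> 'n diffop"
    by (rule sum.reindex_bij_witness[of _ "\<lambda>r k. r (inverse w \<langle>$\<rangle> k)" "\<lambda>r k. r (w \<langle>$\<rangle> k)"]) auto
  from this[of "\<lambda>r. perm_diffop w (A $ _ $ r * B $ r $ _)"]
  show ?thesis
    by (simp add: vec_eq_iff hat_action_entry matrix_matrix_mult_def perm_diffop_sum perm_diffop_mult)
qed

text \<open>An element $\sum_w a_w \widehat w$ of the crossed product is given by its coefficients $a_w$.
  In the product, $a_u \widehat u \cdot b_v \widehat v = a_u\,(\widehat u.b_v)\,\widehat{uv}$.\<close>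

typedef ('n, 'd) crossed = "UNIV :: ('n::finite perm \<Rightarrow> ('n, 'd::finite) diffop_matrix) set"
  morphisms coeff Crossed ..

lifting_forget diffop.lifting
lifting_forget perm.lifting
setup_lifting type_definition_crossed

lemma matrix_mult_add_left: "(A + B) ** C = A ** C + B ** (C :: 'a::ring_1 ^ 'b ^ 'c::finite)"
  by (simp add: vec_eq_iff matrix_matrix_mult_def distrib_right sum.distrib)

lemma matrix_mult_0_left: "0 ** (C :: 'a::ring_1 ^ 'b ^ 'c::finite) = 0"
  by (simp add: vec_eq_iff matrix_matrix_mult_def)

lemma matrix_mult_0_right: "(C :: 'a::ring_1 ^ 'b::finite ^ 'c) ** 0 = 0"
  by (simp add: vec_eq_iff matrix_matrix_mult_def)

lemma matrix_sum_left: "(\<Sum>x\<in>S. A x) ** B = (\<Sum>x\<in>S. A x ** (B :: 'a::ring_1 ^ 'b ^ 'c::finite))"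
  by (induction S rule: infinite_finite_induct) (simp_all add: matrix_mult_add_left matrix_mult_0_left)

lemma matrix_sum_right: "A ** (\<Sum>x\<in>S. B x) = (\<Sum>x\<in>S. (A :: 'a::ring_1 ^ 'b::finite ^ 'c) ** B x)"
  by (induction S rule: infinite_finite_induct) (simp_all add: matrix_add_ldistrib matrix_mult_0_right)

instantiation crossed :: (finite, finite) ring_1
begin
lift_definition zero_crossed :: "('a, 'b) crossed" is "\<lambda>_. 0" .
lift_definition one_crossed :: "('a, 'b) crossed" is "\<lambda>w. if w = 1 then mat 1 else 0" .
lift_definition plus_crossed :: "('a, 'b) crossed \<Rightarrow> ('a, 'b) crossed \<Rightarrow> ('a, 'b) crossed" is
  "\<lambda>a b w. a w + b w" .
lift_definition minus_crossed :: "('a, 'b) crossed \<Rightarrow> ('a, 'b) crossed \<Rightarrow> ('a, 'b) crossed" is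
  "\<lambda>a b w. a w - b w" .
lift_definition uminus_crossed :: "('a, 'b) crossed \<Rightarrow> ('a, 'b) crossed" is "\<lambda>a w. - a w" .
lift_definition times_crossed :: "('a, 'b) crossed \<Rightarrow> ('a, 'b) crossed \<Rightarrow> ('a, 'b) crossed" is
  "\<lambda>a b w. \<Sum>u\<in>UNIV. a u ** hat_action u (b (inverse u * w))" .
instance
proof
  fix a b c :: "('a, 'b) crossed"
  show "a + b + c = a + (b + c)" by transfer (simp add: add.assoc)
  show "a + b = b + a" by transfer (simp add: add.commute)
  show "0 + a = a" by transfer simp
  show "- a + a = 0" by transfer simp
  show "a - b = a + - b" by transfer simp
  show "(a + b) * c = a * c + b * c" by transfer (simp add: matrix_mult_add_left sum.distrib)
  show "a * (b + c) = a * b + a * c" by transfer (simp add: matrix_add_ldistrib hat_action_add sum.distrib)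
  show "1 * a = a"
    by transfer (simp add: if_distrib[of "\<lambda>x. x ** _"] matrix_mul_lid matrix_mult_0_left hat_action_1 cong: if_cong)
  show "a * 1 = a"
  proof (transfer, rule ext)
    fix a :: "'a perm \<Rightarrow> ('a,'b) diffop_matrix" and w :: "'a perm"
    have "(inverse u * w = 1) = (u = w)" for u
    proof
      assume "inverse u * w = 1"
      hence "u * (inverse u * w) = u" by simp
      thus "u = w" by (simp flip: mult.assoc)
    qed simp
    hence "a u ** hat_action u (if inverse u * w = 1 then mat 1 else 0) = (if u = w then a u else 0)" for u
      by (simp add: hat_action_one hat_action_0 matrix_mul_rid matrix_mult_0_right)
    thus "(\<Sum>u\<in>UNIV. a u ** hat_action u (if inverse u * w = 1 then mat 1 else 0)) = a w" by simp
  qed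
  show "a * b * c = a * (b * c)"
  proof (transfer, rule ext)
    fix a b c :: "'a perm \<Rightarrow> ('a,'b) diffop_matrix" and w :: "'a perm"
    have "(\<Sum>u\<in>UNIV. (\<Sum>v\<in>UNIV. a v ** hat_action v (b (inverse v * u))) ** hat_action u (c (inverse u * w)))
        = (\<Sum>v\<in>UNIV. \<Sum>u\<in>UNIV. a v ** hat_action v (b (inverse v * u)) ** hat_action u (c (inverse u * w)))"
      unfolding matrix_sum_left by (rule sum.swap)
    also have "\<dots> = (\<Sum>v\<in>UNIV. \<Sum>u\<in>UNIV. a v ** hat_action v (b u) ** hat_action (v * u) (c (inverse (v * u) * w)))"
    proof (rule sum.cong[OF refl])
      fix v :: "'a perm"
      show "(\<Sum>u\<in>UNIV. a v ** hat_action v (b (inverse v * u)) ** hat_action u (c (inverse u * w)))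
        = (\<Sum>u\<in>UNIV. a v ** hat_action v (b u) ** hat_action (v * u) (c (inverse (v * u) * w)))"
        by (rule sum.reindex_bij_witness[of _ "\<lambda>u. v * u" "\<lambda>u. inverse v * u"])
           (simp_all flip: mult.assoc)
    qed
    also have "\<dots> = (\<Sum>v\<in>UNIV. a v ** hat_action v (\<Sum>u\<in>UNIV. b u ** hat_action u (c (inverse u * (inverse v * w)))))"
      by (simp add: hat_action_sum matrix_sum_right hat_action_times hat_action_mult matrix_mul_assoc mult.assoc)
    finally show "(\<Sum>u\<in>UNIV. (\<Sum>v\<in>UNIV. a v ** hat_action v (b (inverse v * u))) ** hat_action u (c (inverse u * w)))
       = (\<Sum>v\<in>UNIV. a v ** hat_action v (\<Sum>u\<in>UNIV. b u ** hat_action u (c (inverse u * (inverse v * w)))))" .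
  qed
  show "0 \<noteq> (1 :: ('a, 'b) crossed)"
  proof transfer
    have "(0 :: ('a,'b) diffop_matrix) $ p $ p \<noteq> mat 1 $ p $ p" for p by (simp add: mat_def)
    hence "(0 :: ('a,'b) diffop_matrix) \<noteq> mat 1" by metis
    thus "(\<lambda>_. 0) \<noteq> (\<lambda>w::'a perm. if w = 1 then mat 1 else (0 :: ('a,'b) diffop_matrix))"
      by (metis (full_types))
  qed
qed
end

lift_definition embed :: "('n::finite, 'd::finite) diffop_matrix \<Rightarrow> ('n, 'd) crossed" is
  "\<lambda>A w. if w = 1 then A else 0" .

lift_definition hat :: "'n perm \<Rightarrow> ('n::finite, 'd::finite) crossed" is
  "\<lambda>w v. if v = w then mat 1 else 0" .

lemma perm_inverse_times_eq: "(inverse u * w = v) = (w = u * v)" for u v w :: "'n perm"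
  by (metis mult.assoc mult_1_left perm.left_inverse perm.right_inverse)

lemma hat_mult: "hat u * hat w = (hat (u * w) :: ('n::finite, 'd::finite) crossed)"
proof (transfer, rule ext)
  fix u w v :: "'n perm"
  have "(if x = u then mat 1 else 0) ** hat_action x (if inverse x * v = w then mat 1 else 0)
      = (if x = u then if v = u * w then mat 1 else 0 else 0 :: ('n, 'd) diffop_matrix)" for x
    by (simp add: perm_inverse_times_eq matrix_mult_0_left matrix_mul_lid hat_action_one hat_action_0)
  thus "(\<Sum>x\<in>UNIV. (if x = u then mat 1 else 0) ** hat_action x (if inverse x * v = w then mat 1 else 0))
      = (if v = u * w then mat 1 else 0 :: ('n, 'd) diffop_matrix)" by simp
qed

lemma hat_embed:
  fixes A :: "('n::finite, 'd::finite) diffop_matrix"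
  shows "hat w * embed A = embed (hat_action w A) * hat w"
proof (transfer, rule ext)
  fix w v :: "'n perm" and A :: "('n, 'd) diffop_matrix"
  have 1: "(if x = w then mat 1 else 0) ** hat_action x (if inverse x * v = 1 then A else 0)
      = (if x = w then if v = w then hat_action w A else 0 else 0)" for x
    by (simp add: perm_inverse_times_eq matrix_mult_0_left matrix_mul_lid hat_action_0)
  have 2: "(if x = 1 then hat_action w A else 0) ** hat_action x (if inverse x * v = w then mat 1 else 0)
      = (if x = 1 then if v = w then hat_action w A else 0 else 0)" for x
    by (simp add: perm_inverse_times_eq matrix_mult_0_left matrix_mult_0_right matrix_mul_rid hat_action_1)
  show "(\<Sum>x\<in>UNIV. (if x = w then mat 1 else 0) ** hat_action x (if inverse x * v = 1 then A else 0))
      = (\<Sum>x\<in>UNIV. (if x = 1 then hat_action w A else 0) ** hat_action x (if inverse x * v = w then mat 1 else 0))"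
    unfolding 1 2 by simp
qed

definition scalar :: "complex \<Rightarrow> ('n::finite, 'd::finite) crossed" where
  "scalar c = embed (mat (mult_op (const_mero c)))"


section \<open>$R$-matrices\<close>

type_synonym 'd rmatrix = "complex \<Rightarrow> complex \<Rightarrow> complex ^ ('d \<times> 'd) ^ ('d \<times> 'd)"

text \<open>The operator acting as \<open>A\<close> on the tensor factors $i$, $j$ (in this order, $i \neq j$) and as the
  identity on the others.\<close>

definition on_factors ::
  "'m::finite \<Rightarrow> 'm \<Rightarrow> complex ^ ('d::finite \<times> 'd) ^ ('d \<times> 'd) \<Rightarrow> complex ^ ('m \<Rightarrow> 'd) ^ ('m \<Rightarrow> 'd)" where
  "on_factors i j A =
     (\<chi> p q. if \<forall>k. k \<noteq> i \<and> k \<noteq> j \<longrightarrow> p k = q k then A $ (p i, p j) $ (q i, q j) else 0)"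

definition flip :: "complex ^ ('d::finite \<times> 'd) ^ ('d \<times> 'd)" where
  "flip = (\<chi> p q. if p = (snd q, fst q) then 1 else 0)"

definition rmatrix_entry :: "'d::finite rmatrix \<Rightarrow> 'd \<times> 'd \<Rightarrow> 'd \<times> 'd \<Rightarrow> complex ^ 2 \<Rightarrow> complex" where
  "rmatrix_entry R p q = (\<lambda>v. R (v $ 1) (v $ 2) $ p $ q)"

definition rmatrix_meromorphic :: "'d::finite rmatrix \<Rightarrow> bool" where
  "rmatrix_meromorphic R \<longleftrightarrow> (\<forall>p q. mero_fun (rmatrix_entry R p q))"

definition skew_symmetric :: "'d::finite rmatrix \<Rightarrow> bool" where
  "skew_symmetric R \<longleftrightarrow>
     generically (\<lambda>(z, \<mu>). R (- z) (- \<mu>) = - (flip ** R z \<mu> ** flip))"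

definition associative_YBE :: "'d::finite rmatrix \<Rightarrow> bool" where
  "associative_YBE R \<longleftrightarrow>
     (let R12 = \<lambda>z \<mu>. on_factors (1::3) 2 (R z \<mu>);
          R13 = \<lambda>z \<mu>. on_factors (1::3) 3 (R z \<mu>);
          R23 = \<lambda>z \<mu>. on_factors (2::3) 3 (R z \<mu>)
      in generically (\<lambda>(z, \<mu>, z', \<mu>').
           R12 z \<mu> ** R23 z' \<mu>' =
             R13 (z + z') \<mu>' ** R12 z (\<mu> - \<mu>') + R23 z' (\<mu>' - \<mu>) ** R13 (z + z') \<mu>))"

definition period_lattice :: "complex \<Rightarrow> complex \<Rightarrow> complex set" where
  "period_lattice \<omega>1 \<omega>2 = {of_int m * \<omega>1 + of_int n * \<omega>2 | m n. True}"

definition weierstrass_p :: "complex \<Rightarrow> complex \<Rightarrow> complex \<Rightarrow> complex" where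
  "weierstrass_p \<omega>1 \<omega>2 z =
     1 / z\<^sup>2 + (\<Sum>\<^sub>\<infinity>\<omega>\<in>period_lattice \<omega>1 \<omega>2 - {0}. 1 / (z - \<omega>)\<^sup>2 - 1 / \<omega>\<^sup>2)"

text \<open>The elliptic function of a lattice (the condition on \<open>\<omega>1\<close>, \<open>\<omega>2\<close> is linear independence over
  the reals), its trigonometric degenerations, obtained by letting one period tend to infinity (hyperbolic
  ones arise from non-real \<open>\<omega>\<close>), and the rational one. Their additive normalization is
  irrelevant below, as only differences of values occur.\<close>

definition weierstrass_functions :: "(complex \<Rightarrow> complex) set" where
  "weierstrass_functions =
     {weierstrass_p \<omega>1 \<omega>2 | \<omega>1 \<omega>2. \<omega>1 \<noteq> 0 \<and> Im (\<omega>2 / \<omega>1) \<noteq> 0}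
     \<union> {\<lambda>z. (of_real pi / \<omega>)\<^sup>2 * (1 / (sin (of_real pi * z / \<omega>))\<^sup>2 - 1 / 3) | \<omega>. \<omega> \<noteq> 0}
     \<union> {\<lambda>z. 1 / z\<^sup>2}"

definition unitary_rmatrix :: "'d::finite rmatrix \<Rightarrow> bool" where
  "unitary_rmatrix R \<longleftrightarrow>
     (\<exists>P\<in>weierstrass_functions.
        generically (\<lambda>(z, \<mu>). R z \<mu> ** (flip ** R (- z) \<mu> ** flip) = mat (P \<mu> - P z)))"

definition simple_pole_residue :: "(complex \<Rightarrow> complex ^ 'k::finite ^ 'm::finite) \<Rightarrow> complex ^ 'k ^ 'm \<Rightarrow> bool" where
  "simple_pole_residue F \<rho> \<longleftrightarrow> \<rho> \<noteq> 0 \<and>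
     (\<forall>p q. \<exists>h. h analytic_on {0} \<and> (\<forall>\<^sub>F \<mu> in at 0. F \<mu> $ p $ q = \<rho> $ p $ q / \<mu> + h \<mu>))"

definition regular_rmatrix :: "'d::finite rmatrix \<Rightarrow> bool" where
  "regular_rmatrix R \<longleftrightarrow> (\<exists>\<rho>. generically (\<lambda>z. simple_pole_residue (R z) \<rho>))"

text \<open>A value \<open>\<mu>\<close> of the spectral parameter can be substituted into $R$ when the line on which the
  second variable equals \<open>\<mu>\<close> is not contained in the polar locus; $R(z, \mu)$ is then a meromorphic
  function of $z$. Holomorphy of $R$ near the generic point of the line guarantees that the restriction of
  the total function \<open>R\<close> is the restriction of the meromorphic function it represents.\<close>

definition spectral_value :: "'d::finite rmatrix \<Rightarrow> complex \<Rightarrow> bool" where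
  "spectral_value R \<mu> \<longleftrightarrow>
     generically (\<lambda>z. \<exists>N. open N \<and> vector [z, \<mu>] \<in> N \<and> (\<forall>p q. holo_on (rmatrix_entry R p q) N)) \<and>
     (\<forall>p q. (\<lambda>z. R z \<mu> $ p $ q) meromorphic_on UNIV)"


section \<open>Dunkl operators\<close>

text \<open>$R_{ij}(x_i - x_j, \mu)$ as an element of $\mathcal{D}(V) \otimes \mathrm{End}\,U$\<close>

definition R_factor :: "'d::finite rmatrix \<Rightarrow> 'n::finite \<Rightarrow> 'n \<Rightarrow> complex \<Rightarrow> ('n, 'd) diffop_matrix" where
  "R_factor R i j \<mu> =
     (\<chi> p q. mult_op (abs_mero (\<lambda>x. on_factors i j (R (x $ i - x $ j) \<mu>) $ p $ q)))"

text \<open>The spectral parameters enter as complex numbers, so they commute with everything; for fixed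
  \<open>lam\<close> these are elements of the crossed product, which makes sense if all differences
  \<open>lam $ i - lam $ j\<close> are spectral values.\<close>

definition dunkl_coord ::
  "'d::finite rmatrix \<Rightarrow> complex \<Rightarrow> complex \<Rightarrow> complex ^ 'n::finite \<Rightarrow> 'n \<Rightarrow> ('n, 'd) crossed" where
  "dunkl_coord R hbar g lam i =
     scalar hbar * embed (mat (pderiv_op i))
     - scalar g * (\<Sum>j\<in>UNIV - {i}. embed (R_factor R i j (lam $ i - lam $ j)) * hat \<langle>i \<leftrightarrow> j\<rangle>)"

definition dunkl ::
  "'d::finite rmatrix \<Rightarrow> complex \<Rightarrow> complex \<Rightarrow> complex ^ 'n::finite \<Rightarrow> complex ^ 'n \<Rightarrow> ('n, 'd) crossed" where
  "dunkl R hbar g lam \<xi> = (\<Sum>i\<in>UNIV. scalar (\<xi> $ i) * dunkl_coord R hbar g lam i)"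

definition commutator :: "'a::ring \<Rightarrow> 'a \<Rightarrow> 'a" where
  "commutator a b = a * b - b * a"

unbundle no permutation_syntax

end

theory Submission
  imports Defs
begin

unbundle permutation_syntax

text \<open>Write $A_{ij} = R_{ij}(x_i - x_j, \lambda_i - \lambda_j)\,\widehat s_{ij}$, so that
  $y_i = \hbar\,\partial_i - g \sum_{j \neq i} A_{ij}$. Since $\widehat w$ does not move the spectral
  parameters, pulling $\widehat s_{ij}$ through the $R$-matrix of $A_{jk}$ turns $R_{jk}(x_j - x_k, \lambda_j - \lambda_k)$ into
  $R_{ik}(x_i - x_k, \lambda_j - \lambda_k)$: the positions are exchanged, the parameters are not.
  This mismatch is what the associative Yang--Baxter equation asks for. It becomes the
  relation $A_{ij} A_{jk} = A_{ik} A_{ij} + A_{jk} A_{ik}$ among the $A_{ij}$, because the three products of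
  transpositions that occur are the same 3-cycle. Skew symmetry becomes $A_{ji} = - A_{ij}$.

  Commutativity of the $y_i$ then needs only these two relations, the vanishing of $[A_{ij}, A_{kl}]$ for disjoint
  pairs, and the fact that $A_{ij}$ commutes with $\partial_i + \partial_j$ and with every other
  $\partial_k$. That part is pure ring theory (\<open>dunkl_type_operators_commute\<close>). Equivariance holds term by
  term, since conjugation by $\widehat w$ renames the indices of $\partial_i$ and of $R_{ij}$
  and conjugates $s_{ij}$ to $s_{w(i)\,w(j)}$.

  The analytic work is to get from the assumptions on $R$, which hold at generic points of
  $\mathbb{C}^2$ and $\mathbb{C}^4$, to identities in the crossed product for a fixed \<open>lam\<close>. The subspaces
  on which the spectral parameters are fixed are nowhere dense, so genericity alone says nothing about them.
  But if $R$ is holomorphic near all the arguments that occur, both sides of an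
  identity are continuous there and agree on a dense set, so they agree
  (\<open>associative_YBE_at\<close>, \<open>skew_symmetric_at\<close>); and for spectral values of the parameters this is the
  situation at a generic $x \in \mathbb{C}^n$. Finally, the derivations $\partial_i$ of the field of
  meromorphic functions have to commute, which is the symmetry of second derivatives
  (\<open>pderiv_at_commute\<close>).\<close>

section \<open>Commuting operators of Dunkl type in a ring\<close>

lemma commutator_self: "commutator a a = 0"
  by (simp add: commutator_def)

lemma commutator_add_left: "commutator (a + b) c = commutator a c + commutator b c"
  and commutator_add_right: "commutator c (a + b) = commutator c a + commutator c b"
  and commutator_diff_left: "commutator (a - b) c = commutator a c - commutator b c"
  and commutator_diff_right: "commutator c (a - b) = commutator c a - commutator c b"
  and commutator_minus_right: "commutator a (- b) = - commutator a b"
  and commutator_swap: "commutator a b = - commutator b a"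
  by (simp_all add: commutator_def algebra_simps)

lemma commutator_sum_left: "commutator (sum f S) a = (\<Sum>x\<in>S. commutator (f x) a)"
  and commutator_sum_right: "commutator a (sum f S) = (\<Sum>x\<in>S. commutator a (f x))"
  by (simp_all add: commutator_def sum_distrib_left sum_distrib_right sum_subtractf)

lemma commutator_central_left:
  assumes "\<And>x. c * x = x * c"
  shows "commutator (c * a) b = c * commutator a b"
proof -
  have "b * (c * a) = c * (b * a)"
    using assms[of b] by (metis mult.assoc)
  thus ?thesis by (simp add: commutator_def right_diff_distrib mult.assoc)
qed

lemma commutator_central_right:
  assumes "\<And>x. c * x = x * c"
  shows "commutator a (c * b) = c * commutator a b"
  using commutator_central_left[OF assms, of b a] commutator_swap[of a "c * b"] commutator_swap[of a b]
  by simp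

text \<open>The algebraic core. The terms of degree one in \<open>h\<close> reduce to $[d_i + d_j, A_{ij}] = 0$, because
  $A_{ji} = - A_{ij}$. In $[\sum_k A_{ik}, \sum_l A_{jl}]$ all terms with four distinct
  indices vanish, and the terms with a given third index $k$ are
  $[A_{ij}, A_{jk}] + [A_{ij}, A_{ik}] + [A_{ik}, A_{jk}]$. Up to skew symmetry, this is the difference of two
  instances of the three-term relation, so it vanishes as well.\<close>

lemma dunkl_type_operators_commute:
  fixes h g :: "'a::ring_1" and d :: "'n::finite \<Rightarrow> 'a" and A :: "'n \<Rightarrow> 'n \<Rightarrow> 'a"
  assumes h: "\<And>x. h * x = x * h" and g: "\<And>x. g * x = x * g"
    and dd: "\<And>i j. commutator (d i) (d j) = 0"
    and dA: "\<And>i j k. distinct [i, j, k] \<Longrightarrow> commutator (d i) (A j k) = 0"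
    and dA_sum: "\<And>i j. i \<noteq> j \<Longrightarrow> commutator (d i + d j) (A i j) = 0"
    and skew: "\<And>i j. i \<noteq> j \<Longrightarrow> A j i = - A i j"
    and disj: "\<And>i j k l. distinct [i, j, k, l] \<Longrightarrow> commutator (A i j) (A k l) = 0"
    and ybe: "\<And>i j k. distinct [i, j, k] \<Longrightarrow> A i j * A j k = A i k * A i j + A j k * A i k"
  shows "commutator (h * d i - g * (\<Sum>k\<in>UNIV - {i}. A i k)) (h * d j - g * (\<Sum>k\<in>UNIV - {j}. A j k)) = 0"
proof (cases "i = j")
  case False
  define K where "K = UNIV - {i, j}"
  have split_i: "(\<Sum>k\<in>UNIV - {i}. A i k) = A i j + (\<Sum>k\<in>K. A i k)"
    using False sum.remove[of "UNIV - {i}" j "A i"] by (simp add: K_def Diff_insert2[symmetric] insert_commute[of i j])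
  have split_j: "(\<Sum>k\<in>UNIV - {j}. A j k) = - A i j + (\<Sum>k\<in>K. A j k)"
    using False sum.remove[of "UNIV - {j}" i "A j"] skew[OF False]
    by (simp add: K_def Diff_insert2[symmetric] insert_commute[of i j])
  have K: "distinct [i, j, k]" "distinct [j, i, k]" if "k \<in> K" for k
    using that False by (auto simp: K_def)
  have mixed: "commutator (d i) (\<Sum>k\<in>UNIV - {j}. A j k) = commutator (d j) (\<Sum>k\<in>UNIV - {i}. A i k)"
  proof -
    have "commutator (d i) (\<Sum>k\<in>K. A j k) = 0" "commutator (d j) (\<Sum>k\<in>K. A i k) = 0"
      using dA[OF K(1)] dA[OF K(2)] by (simp_all add: commutator_sum_right)
    moreover have "commutator (d j) (A i j) = - commutator (d i) (A i j)"
      using dA_sum[OF False] by (simp add: commutator_add_left eq_neg_iff_add_eq_0 add.commute)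
    ultimately show ?thesis
      by (simp add: split_i split_j commutator_add_right commutator_diff_right)
  qed
  have triple: "commutator (A i j) (A j k) + commutator (A i j) (A i k) + commutator (A i k) (A j k) = 0"
    if "k \<in> K" for k
  proof -
    have ne: "i \<noteq> j" "i \<noteq> k" "j \<noteq> k" using K[OF that] by auto
    show ?thesis
      \<comment> \<open>The six products split into two groups of three, one for each of the two 3-cycles on
        $\{i, j, k\}$, and each group is one instance of the relation.\<close>
      using ybe[of i k j] ybe[of k i j] skew[OF ne(1)] skew[OF ne(2)] skew[OF ne(3)] ne
      by (simp add: commutator_def algebra_simps)
  qed
  have quadratic: "commutator (\<Sum>k\<in>UNIV - {i}. A i k) (\<Sum>k\<in>UNIV - {j}. A j k) = 0"
  proof -
    have "commutator (\<Sum>k\<in>K. A i k) (\<Sum>l\<in>K. A j l) = (\<Sum>k\<in>K. commutator (A i k) (A j k))"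
      unfolding commutator_sum_left[of _ K] unfolding commutator_sum_right[of _ _ K]
    proof (rule sum.cong[OF refl])
      fix k assume k: "k \<in> K"
      have "commutator (A i k) (A j l) = 0" if "l \<in> K - {k}" for l
        using disj[of i k j l] that k K by auto
      thus "(\<Sum>l\<in>K. commutator (A i k) (A j l)) = commutator (A i k) (A j k)"
        using sum.remove[of K k "\<lambda>l. commutator (A i k) (A j l)"] k by simp
    qed
    moreover have "commutator (\<Sum>k\<in>K. A i k) (- A i j) = (\<Sum>k\<in>K. commutator (A i j) (A i k))"
      by (simp add: commutator_sum_left commutator_minus_right commutator_swap[of "A i j"] sum_negf)
    moreover have "commutator (A i j) (\<Sum>k\<in>K. A j k) = (\<Sum>k\<in>K. commutator (A i j) (A j k))"
      by (rule commutator_sum_right)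
    moreover have "commutator (A i j) (- A i j) = 0"
      by (simp add: commutator_minus_right commutator_self)
    ultimately have "commutator (\<Sum>k\<in>UNIV - {i}. A i k) (\<Sum>k\<in>UNIV - {j}. A j k) =
        (\<Sum>k\<in>K. commutator (A i j) (A j k) + commutator (A i j) (A i k) + commutator (A i k) (A j k))"
      unfolding split_i split_j
      by (simp only: commutator_add_left commutator_add_right sum.distrib) (simp only: add_0_left add_ac)
    also have "\<dots> = 0" using triple by simp
    finally show ?thesis .
  qed
  have "commutator (\<Sum>k\<in>UNIV - {i}. A i k) (d j) = - commutator (d i) (\<Sum>k\<in>UNIV - {j}. A j k)"
    using mixed commutator_swap[of _ "d j"] by simp
  moreover have "h * (g * x) = g * (h * x)" for x
    using h[of g] by (simp flip: mult.assoc)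
  ultimately show ?thesis
    by (simp add: commutator_diff_left commutator_diff_right commutator_central_left[OF h]
        commutator_central_left[OF g] commutator_central_right[OF h] commutator_central_right[OF g]
        quadratic dd)
qed (simp add: commutator_self)

section \<open>Meromorphic functions\<close>

lemma abs_mero_eqI:
  "mero_fun f \<Longrightarrow> mero_fun g \<Longrightarrow> generically (\<lambda>x. f x = g x) \<Longrightarrow> abs_mero f = abs_mero g"
  using Quotient_rel_abs[OF Quotient_mero] by blast

lemma abs_mero_plus: "mero_fun f \<Longrightarrow> mero_fun g \<Longrightarrow> abs_mero f + abs_mero g = abs_mero (\<lambda>x. f x + g x)"
  by (rule plus_mero.abs_eq) (simp_all add: eq_onp_def generically_UNIV)

lemma abs_mero_mult: "mero_fun f \<Longrightarrow> mero_fun g \<Longrightarrow> abs_mero f * abs_mero g = abs_mero (\<lambda>x. f x * g x)"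
  by (rule times_mero.abs_eq) (simp_all add: eq_onp_def generically_UNIV)

lemma abs_mero_zero: "abs_mero (\<lambda>x. 0) = 0"
  by (simp add: zero_mero.abs_eq)

lemma abs_mero_uminus: "mero_fun f \<Longrightarrow> - abs_mero f = abs_mero (\<lambda>x. - f x)"
  by (rule uminus_mero.abs_eq) (simp_all add: eq_onp_def generically_UNIV)

lemma pderiv_abs_mero: "mero_fun f \<Longrightarrow> pderiv_mero i (abs_mero f) = abs_mero (pderiv_at i f)"
  by (rule pderiv_mero.abs_eq) (simp_all add: eq_onp_def generically_UNIV)

lemma perm_abs_mero: "mero_fun f \<Longrightarrow> perm_mero w (abs_mero f) = abs_mero (\<lambda>x. f (perm_vec (inverse w) x))"
  by (rule perm_mero.abs_eq) (simp_all add: eq_onp_def generically_UNIV)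

lemma mero_cases:
  obtains f where "mero_fun f" "F = abs_mero f"
  using Quotient_abs_rep[OF Quotient_mero, of F] Quotient_rep_reflp[OF Quotient_mero, of F] by metis

lemma mero_fun_sum: "(\<And>x. x \<in> S \<Longrightarrow> mero_fun (f x)) \<Longrightarrow> mero_fun (\<lambda>y. \<Sum>x\<in>S. f x y)"
  by (induction S rule: infinite_finite_induct) (simp_all add: mero_fun_const mero_fun_add)

lemma abs_mero_sum:
  "(\<And>x. x \<in> S \<Longrightarrow> mero_fun (f x)) \<Longrightarrow> (\<Sum>x\<in>S. abs_mero (f x)) = abs_mero (\<lambda>y. \<Sum>x\<in>S. f x y)"
  by (induction S rule: infinite_finite_induct) (simp_all add: abs_mero_zero abs_mero_plus mero_fun_sum)

lemma generically_holo_at: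
  assumes "mero_fun f"
  shows "generically (\<lambda>x. \<exists>N. open N \<and> x \<in> N \<and> holo_on f N)"
proof -
  obtain D where "open D" "closure D = UNIV" "holo_on f D"
    using mero_fun_holo[OF assms] .
  thus ?thesis unfolding generically_def by blast
qed

lemma pderiv_at_mult:
  assumes "holo_on f N" "x \<in> N" "holo_on g N'" "x \<in> N'"
  shows "pderiv_at i (\<lambda>y. f y * g y) x = pderiv_at i f x * g x + f x * pderiv_at i g x"
proof -
  obtain f' where f': "(f has_derivative f') (at x)" "\<And>c v. f' (c *s v) = c * f' v"
    using assms unfolding holo_on_def by blast
  obtain g' where g': "(g has_derivative g') (at x)" "\<And>c v. g' (c *s v) = c * g' v"
    using assms unfolding holo_on_def by blast
  show ?thesis
    using DERIV_imp_deriv[OF DERIV_mult[OF holo_on_deriv_sum(1)[OF f', of i] holo_on_deriv_sum(1)[OF g', of i]]]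
    by (simp add: pderiv_at_def DERIV_imp_deriv[OF holo_on_deriv_sum(1)[OF f', of i]]
        DERIV_imp_deriv[OF holo_on_deriv_sum(1)[OF g', of i]] mult.commute)
qed

lemma pderiv_mero_mult: "pderiv_mero i (F * G) = pderiv_mero i F * G + F * pderiv_mero i G"
proof -
  obtain f where f: "mero_fun f" "F = abs_mero f" by (rule mero_cases)
  obtain g where g: "mero_fun g" "G = abs_mero g" by (rule mero_cases)
  have "generically (\<lambda>x. pderiv_at i (\<lambda>y. f y * g y) x = pderiv_at i f x * g x + f x * pderiv_at i g x)"
  proof (rule generically_conj_imp[OF generically_holo_at[OF f(1)] generically_holo_at[OF g(1)]], elim exE conjE)
  qed (rule pderiv_at_mult)
  thus ?thesis
    by (auto simp: f g abs_mero_mult abs_mero_plus pderiv_abs_mero mero_fun_mult mero_fun_add mero_fun_pderiv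
        intro!: abs_mero_eqI)
qed

text \<open>Cauchy's formula writes $\partial_i f$ as an integral of values of $f$ over a circle in the $i$-th
  direction. Differentiating under the integral sign in the direction $j$ gives the same integral for $\partial_j f$,
  which by Cauchy's formula again is $\partial_i \partial_j f$.\<close>

lemma pderiv_at_commute:
  fixes f :: "complex ^ 'n \<Rightarrow> complex"
  assumes f: "holo_on f S" and S: "open S" and x: "x \<in> S"
  shows "pderiv_at j (pderiv_at i f) x = pderiv_at i (pderiv_at j f) x"
proof -
  obtain r where r: "r > 0" "ball x (3 * r) \<subseteq> S"
  proof -
    \<comment> \<open>One radius for the circle, one for moving its centre in the direction $j$, and a third to spare.\<close>
    obtain e where "e > 0" "ball x e \<subseteq> S" using S x openE by blast
    thus ?thesis using that[of "e/3"] by simp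
  qed
  define c where "c = circlepath 0 r"
  have nc: "norm (c t) = r" for t using r by (simp add: c_def circlepath norm_mult)
  have nc0: "c t \<noteq> 0" for t using nc[of t] r by auto
  have cc: "continuous_on X c" for X
    unfolding c_def circlepath by (intro continuous_intros)
  let ?p = "\<lambda>u t. x + u *s axis j 1 + c t *s axis i 1"
  have inS: "?p u t \<in> S" if "u \<in> ball 0 r" for u t
  proof -
    have "dist x (?p u t) \<le> norm (u *s axis j (1::complex) :: complex^'n) + norm (c t *s axis i (1::complex) :: complex^'n)"
      using norm_triangle_ineq[of "u *s axis j (1::complex) :: complex^'n" "c t *s axis i 1"]
      by (metis add.assoc add_diff_cancel_left' dist_commute dist_norm)
    also have "\<dots> < 3 * r" using that nc r by (simp add: norm_smult_axis)
    finally show ?thesis using r by auto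
  qed
  have cp: "continuous_on X (\<lambda>(u, t). ?p u t)" for X
    unfolding split_beta
    by (intro continuous_intros bounded_linear.continuous_on[OF bl_smult_axis]
        continuous_on_compose2[OF cc[of UNIV]]) auto
  have D: "((\<lambda>u. g (x + u *s axis j 1 + v)) has_field_derivative pderiv_at j g (x + u *s axis j 1 + v)) (at u)"
    if g: "holo_on g S" and v: "x + u *s axis j 1 + v \<in> S" for u v and g :: "complex^'n \<Rightarrow> complex"
  proof -
    obtain g' where g': "(g has_derivative g') (at (x + u *s axis j 1 + v))" "\<And>c v. g' (c *s v) = c * g' v"
      using g v unfolding holo_on_def by blast
    have "((\<lambda>t. g (x + u *s axis j 1 + v + t *s axis j 1)) has_field_derivative pderiv_at j g (x + u *s axis j 1 + v)) (at 0)"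
      using holo_on_deriv_sum(1,2)[OF g', of j] by simp
    hence "((\<lambda>t. g (x + (u + t) *s axis j 1 + v)) has_field_derivative pderiv_at j g (x + u *s axis j 1 + v)) (at 0)"
      by (simp add: vector_sadd_rdistrib add_ac)
    thus ?thesis
      using DERIV_shift[of "\<lambda>u. g (x + u *s axis j 1 + v)" _ 0 u] by (simp add: add.commute)
  qed
  have Cauchy: "pderiv_at i g (x + u *s axis j 1) = integral (cbox 0 1) (\<lambda>t. g (?p u t) / c t)"
    if g: "holo_on g S" and u: "u \<in> ball 0 r" for g u
    unfolding c_def
  proof (rule pderiv_at_integral[OF g r(1)])
    show "cball (x + u *s axis j 1) r \<subseteq> S"
    proof
      fix z assume "z \<in> cball (x + u *s axis j 1) r"
      moreover have "dist x (x + u *s axis j 1) < r" using u by (simp add: dist_norm norm_smult_axis)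
      ultimately have "dist x z < 3 * r" using dist_triangle[of x z "x + u *s axis j 1"] r by simp
      thus "z \<in> S" using r by auto
    qed
  qed
  have hj: "holo_on (pderiv_at j f) S" by (rule holo_on_pderiv_at[OF f S])
  have "((\<lambda>u. integral (cbox 0 1) (\<lambda>t. f (?p u t) / c t)) has_field_derivative
      integral (cbox 0 1) (\<lambda>t. pderiv_at j f (?p 0 t) / c t)) (at 0 within ball 0 r)"
  proof (rule leibniz_rule_field_derivative)
    fix u t assume u: "u \<in> ball (0::complex) r"
    show "((\<lambda>u. f (?p u t) / c t) has_field_derivative pderiv_at j f (?p u t) / c t) (at u within ball 0 r)"
      by (intro DERIV_cdivide has_field_derivative_at_within[OF D] f inS u)
  next
    fix u assume u: "u \<in> ball (0::complex) r"
    have "continuous_on (cbox 0 1) (\<lambda>t. ?p u t)"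
      by (intro continuous_intros bounded_linear.continuous_on[OF bl_smult_axis] cc)
    hence "continuous_on (cbox 0 1) (\<lambda>t. f (?p u t))"
      by (rule continuous_on_compose2[OF holo_on_imp_continuous_on[OF f]]) (use inS[OF u] in auto)
    thus "(\<lambda>t. f (?p u t) / c t) integrable_on cbox 0 1"
      by (intro integrable_continuous continuous_on_divide cc) (use nc0 in auto)
  next
    show "continuous_on (ball 0 r \<times> cbox 0 1) (\<lambda>(u, t). pderiv_at j f (?p u t) / c t)"
      unfolding split_beta
    proof (rule continuous_on_divide)
      show "continuous_on (ball 0 r \<times> cbox 0 1) (\<lambda>p. pderiv_at j f (?p (fst p) (snd p)))"
        by (rule continuous_on_compose2[OF holo_on_imp_continuous_on[OF hj] cp[unfolded split_beta]])
           (use inS in auto)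
      show "continuous_on (ball 0 r \<times> cbox 0 1) (\<lambda>p. c (snd p))"
        by (rule continuous_on_compose2[OF cc[of UNIV] continuous_on_snd[OF continuous_on_id]]) simp
    qed (use nc0 in simp)
  qed (use r in auto)
  moreover have "integral (cbox 0 1) (\<lambda>t. pderiv_at j f (?p 0 t) / c t) = pderiv_at i (pderiv_at j f) x"
    using Cauchy[OF hj, of 0, symmetric] r(1) by simp
  moreover have "at 0 within ball 0 r = at (0::complex)"
    using r(1) by (intro at_within_open) auto
  ultimately have "((\<lambda>u. integral (cbox 0 1) (\<lambda>t. f (?p u t) / c t)) has_field_derivative
      pderiv_at i (pderiv_at j f) x) (at 0)"
    by (simp only:)
  hence "((\<lambda>u. pderiv_at i f (x + u *s axis j 1)) has_field_derivative pderiv_at i (pderiv_at j f) x) (at 0)"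
  proof (rule has_field_derivative_transform_within_open)
    show "integral (cbox 0 1) (\<lambda>t. f (?p u t) / c t) = pderiv_at i f (x + u *s axis j 1)" if "u \<in> ball 0 r" for u
      by (rule Cauchy[OF f that, symmetric])
  qed (use r(1) in auto)
  thus ?thesis unfolding pderiv_at_def[of j "pderiv_at i f"] by (rule DERIV_imp_deriv)
qed

lemma pderiv_mero_commute: "pderiv_mero i (pderiv_mero j F) = pderiv_mero j (pderiv_mero i F)"
proof -
  obtain f where f: "mero_fun f" "F = abs_mero f" by (rule mero_cases)
  have "generically (\<lambda>x. pderiv_at i (pderiv_at j f) x = pderiv_at j (pderiv_at i f) x)"
    by (rule generically_mono[OF generically_holo_at[OF f(1)]]) (auto intro: pderiv_at_commute)
  thus ?thesis
    by (auto simp: f pderiv_abs_mero mero_fun_pderiv intro!: abs_mero_eqI)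
qed

text \<open>Wherever $f$ is holomorphic, the sum is the derivative of $f$ in the direction $v$.\<close>

lemma sum_pderiv_at_eq_0_if_translation_invariant:
  fixes f :: "complex ^ 'n \<Rightarrow> complex"
  assumes f: "mero_fun f" and inv: "\<And>x t. f (x + t *s v) = f x"
  shows "generically (\<lambda>x. (\<Sum>i\<in>UNIV. v $ i * pderiv_at i f x) = 0)"
proof (rule generically_mono[OF generically_holo_at[OF f]])
  fix x assume "\<exists>N. open N \<and> x \<in> N \<and> holo_on f N"
  then obtain f' where f': "(f has_derivative f') (at x)" "\<And>c v. f' (c *s v) = c * f' v"
    unfolding holo_on_def by blast
  have "linear (\<lambda>t. t *s v)"
    by (rule linearI) (auto simp: vec_eq_iff algebra_simps)
  hence "((\<lambda>t. x + t *s v) has_derivative (\<lambda>t. t *s v)) (at 0)"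
    by (auto intro!: derivative_eq_intros bounded_linear_imp_has_derivative simp: linear_conv_bounded_linear)
  hence "((\<lambda>t. f (x + t *s v)) has_derivative (\<lambda>t. f' (t *s v))) (at 0)"
    by (rule has_derivative_compose) (use f' in simp)
  hence "((\<lambda>t. f x) has_derivative (\<lambda>t. f' (t *s v))) (at 0)"
    by (simp add: inv)
  hence "(\<lambda>t. f' (t *s v)) = (\<lambda>t. 0)"
    by (intro has_derivative_unique[OF _ has_derivative_const])
  from fun_cong[OF this, of 1] show "(\<Sum>i\<in>UNIV. v $ i * pderiv_at i f x) = 0"
    using holo_on_deriv_sum(3)[OF f'] by simp
qed

section \<open>Multiplication and differentiation operators\<close>

lemma diffop_eqI: "(\<And>f. Rep_diffop D f = Rep_diffop E f) \<Longrightarrow> D = E"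
  by (simp add: fun_eq_iff flip: Rep_diffop_inject)

lemma mult_op_plus: "mult_op (a + b) = mult_op a + mult_op b"
  and mult_op_mult: "mult_op (a * b) = mult_op a * mult_op b"
  and mult_op_zero: "mult_op 0 = 0"
  and mult_op_uminus: "mult_op (- a) = - mult_op a"
  by (rule diffop_eqI; simp add: mult_op.rep_eq plus_diffop.rep_eq times_diffop.rep_eq
      zero_diffop.rep_eq uminus_diffop.rep_eq distrib_right mult.assoc)+

lemma mult_op_sum: "mult_op (sum f S) = (\<Sum>x\<in>S. mult_op (f x))"
  by (induction S rule: infinite_finite_induct) (simp_all add: mult_op_zero mult_op_plus)

lemma commutator_pderiv_op: "commutator (pderiv_op i) (pderiv_op j) = 0"
proof -
  have "pderiv_op i * pderiv_op j = pderiv_op j * pderiv_op i"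
    by (rule diffop_eqI) (simp add: pderiv_op.rep_eq times_diffop.rep_eq pderiv_mero_commute)
  thus ?thesis by (simp add: commutator_def)
qed

lemma commutator_pderiv_op_mult_op: "commutator (pderiv_op i) (mult_op a) = mult_op (pderiv_mero i a)"
proof -
  have "pderiv_op i * mult_op a = mult_op (pderiv_mero i a) + mult_op a * pderiv_op i"
    by (rule diffop_eqI)
       (simp add: pderiv_op.rep_eq mult_op.rep_eq times_diffop.rep_eq plus_diffop.rep_eq pderiv_mero_mult)
  thus ?thesis by (simp add: commutator_def)
qed

lemma const_mero_eq: "const_mero c = abs_mero (\<lambda>_. c)"
  by (simp add: const_mero_def)

lemma pderiv_const_mero: "pderiv_mero i (const_mero c) = 0"
proof -
  have "pderiv_at i (\<lambda>_. c) = (\<lambda>_. 0)"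
    by (simp add: pderiv_at_def fun_eq_iff)
  thus ?thesis by (simp add: const_mero_eq pderiv_abs_mero mero_fun_const abs_mero_zero)
qed

lemma perm_const_mero: "perm_mero w (const_mero c) = const_mero c"
  by (simp add: const_mero_eq perm_abs_mero mero_fun_const)

text \<open>A differential operator is linear over the constants, as the generators are.\<close>

lemma mult_op_const_mero_central: "mult_op (const_mero c) * D = D * mult_op (const_mero c)"
proof -
  have *: "const_mero c * E f = E (const_mero c * f)" if "E \<in> diff_operators" for E f
    using that
    by (induction E arbitrary: f rule: diff_operators.induct)
       (simp_all add: mult.left_commute pderiv_mero_mult pderiv_const_mero distrib_left)
  thus ?thesis
    by (intro diffop_eqI) (simp add: times_diffop.rep_eq mult_op.rep_eq * [OF Rep_diffop])
qed

section \<open>Matrices of meromorphic functions\<close>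

definition mero_matrix :: "(complex ^ 'n::finite \<Rightarrow> complex ^ 'k ^ 'm) \<Rightarrow> bool" where
  "mero_matrix F \<longleftrightarrow> (\<forall>p q. mero_fun (\<lambda>x. F x $ p $ q))"

text \<open>The element of $\mathcal D(V) \otimes \mathrm{End}\,U$ of order zero given by a
  meromorphic function with values in $\mathrm{End}\,U$. All factors $R_{ij}$ have this form, so relations
  between them can be checked pointwise at generic points.\<close>

definition mult_matrix :: "(complex ^ 'n::finite \<Rightarrow> complex ^ 'k ^ 'm) \<Rightarrow> 'n diffop ^ 'k ^ 'm" where
  "mult_matrix F = (\<chi> p q. mult_op (abs_mero (\<lambda>x. F x $ p $ q)))"

lemma mero_matrixD: "mero_matrix F \<Longrightarrow> mero_fun (\<lambda>x. F x $ p $ q)"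
  by (simp add: mero_matrix_def)

lemma mero_matrix_mult: "mero_matrix F \<Longrightarrow> mero_matrix G \<Longrightarrow> mero_matrix (\<lambda>x. F x ** G x)"
  by (auto simp: mero_matrix_def matrix_matrix_mult_def intro!: mero_fun_sum mero_fun_mult)

lemma mero_matrix_add: "mero_matrix F \<Longrightarrow> mero_matrix G \<Longrightarrow> mero_matrix (\<lambda>x. F x + G x)"
  by (auto simp: mero_matrix_def intro!: mero_fun_add)

lemma mero_matrix_uminus: "mero_matrix F \<Longrightarrow> mero_matrix (\<lambda>x. - F x)"
  by (auto simp: mero_matrix_def intro!: mero_fun_uminus)

lemma mult_matrix_mult:
  assumes "mero_matrix F" "mero_matrix G"
  shows "mult_matrix (\<lambda>x. F x ** G x) = mult_matrix F ** mult_matrix G"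
  using assms
  by (simp add: mult_matrix_def matrix_matrix_mult_def vec_eq_iff mero_matrixD mero_fun_mult
      flip: abs_mero_sum abs_mero_mult mult_op_mult mult_op_sum)

lemma mult_matrix_add:
  "mero_matrix F \<Longrightarrow> mero_matrix G \<Longrightarrow> mult_matrix (\<lambda>x. F x + G x) = mult_matrix F + mult_matrix G"
  by (simp add: mult_matrix_def vec_eq_iff mero_matrixD flip: abs_mero_plus mult_op_plus)

lemma mult_matrix_uminus: "mero_matrix F \<Longrightarrow> mult_matrix (\<lambda>x. - F x) = - mult_matrix F"
  by (simp add: mult_matrix_def vec_eq_iff mero_matrixD flip: abs_mero_uminus mult_op_uminus)

lemma mult_matrix_cong:
  assumes "mero_matrix F" "mero_matrix G" "generically (\<lambda>x. F x = G x)"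
  shows "mult_matrix F = mult_matrix G"
proof -
  have "abs_mero (\<lambda>x. F x $ p $ q) = abs_mero (\<lambda>x. G x $ p $ q)" for p q
    by (rule abs_mero_eqI) (use assms in \<open>auto simp: mero_matrixD intro: generically_mono\<close>)
  thus ?thesis by (simp add: mult_matrix_def)
qed

lemma matrix_mult_uminus_left: "(- A) ** B = - (A ** B :: 'a::ring_1 ^ 'k ^ 'm)"
  and matrix_mult_uminus_right: "A ** (- B) = - (A ** B :: 'a::ring_1 ^ 'k ^ 'm)"
  by (simp_all add: matrix_matrix_mult_def vec_eq_iff sum_negf)

lemma mat_mult_left: "(mat c ** A) $ p $ q = c * A $ p $ q" for A :: "'a::ring_1 ^ 'k ^ 'm::finite"
  by (simp add: matrix_matrix_mult_def mat_def if_distrib[of "\<lambda>x. x * _"] cong: if_cong)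

lemma mat_mult_right: "(A ** mat c) $ p $ q = A $ p $ q * c" for A :: "'a::ring_1 ^ 'k::finite ^ 'm"
  by (simp add: matrix_matrix_mult_def mat_def if_distrib[of "\<lambda>x. _ * x"] cong: if_cong)

text \<open>This covers both ways in which a derivative commutes with $R_{jk}(x_j - x_k, \mu)$: the singletons $S = \{i\}$
  with $i \neq j, k$, and $S = \{j, k\}$.\<close>

lemma invariant_mult_matrix_commutes:
  fixes F :: "complex ^ 'n::finite \<Rightarrow> complex ^ 'k::finite ^ 'k"
  assumes F: "mero_matrix F" and inv: "\<And>x t. F (x + t *s (\<chi> i. if i \<in> S then 1 else 0)) = F x"
  shows "mat (\<Sum>i\<in>S. pderiv_op i) ** mult_matrix F = mult_matrix F ** mat (\<Sum>i\<in>S. pderiv_op i)"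
proof -
  have "(\<Sum>i\<in>S. pderiv_op i) * mult_op (abs_mero f) = mult_op (abs_mero f) * (\<Sum>i\<in>S. pderiv_op i)"
    if f: "mero_fun f" "\<And>x t. f (x + t *s (\<chi> i. if i \<in> S then 1 else 0)) = f x" for f
  proof -
    have "generically (\<lambda>x. (\<Sum>i\<in>S. pderiv_at i f x) = 0)"
    proof -
      have "(\<Sum>i\<in>UNIV. (\<chi> i. if i \<in> S then 1 else 0) $ i * d i) = (\<Sum>i\<in>S. d i)" for d :: "'n \<Rightarrow> complex"
        by (rule sum.mono_neutral_cong_right) auto
      thus ?thesis using sum_pderiv_at_eq_0_if_translation_invariant[OF f] by (simp only:)
    qed
    hence "abs_mero (\<lambda>x. \<Sum>i\<in>S. pderiv_at i f x) = abs_mero (\<lambda>x. 0)"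
      by (intro abs_mero_eqI mero_fun_sum mero_fun_pderiv mero_fun_const f)
    hence "(\<Sum>i\<in>S. pderiv_mero i (abs_mero f)) = 0"
      by (simp add: pderiv_abs_mero f(1) abs_mero_sum mero_fun_pderiv abs_mero_zero)
    hence "commutator (\<Sum>i\<in>S. pderiv_op i) (mult_op (abs_mero f)) = 0"
      by (simp add: commutator_sum_left commutator_pderiv_op_mult_op mult_op_zero flip: mult_op_sum)
    thus ?thesis by (simp add: commutator_def)
  qed
  from this[OF mero_matrixD[OF F]] show ?thesis
    by (simp add: vec_eq_iff mat_mult_left mat_mult_right mult_matrix_def inv)
qed

section \<open>The crossed product\<close>

lemma crossed_eqI: "(\<And>w. coeff a w = coeff b w) \<Longrightarrow> a = b"
  by (simp add: fun_eq_iff flip: coeff_inject)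

lemma embed_add: "embed (A + B) = embed A + embed B"
  by transfer (auto simp: fun_eq_iff)

lemma embed_uminus: "embed (- A) = - embed A"
  by transfer (auto simp: fun_eq_iff)

lemma embed_mult: "embed (A ** B) = embed A * embed B"
proof (rule crossed_eqI)
  fix w
  have "(if u = 1 then A else 0) ** hat_action u (if inverse u * w = 1 then B else 0) =
      (if u = 1 then if w = 1 then A ** B else 0 else 0)" for u
    by (simp add: matrix_mult_0_left matrix_mult_0_right hat_action_1 perm_inverse_times_eq)
  thus "coeff (embed (A ** B)) w = coeff (embed A * embed B) w"
    by (simp add: embed.rep_eq times_crossed.rep_eq)
qed

lemma hat_1: "hat 1 = (1 :: ('n::finite, 'd::finite) crossed)"
  by (rule crossed_eqI) (simp add: hat.rep_eq one_crossed.rep_eq)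

text \<open>It suffices to check commutation relations on the products $a\,\widehat w$.\<close>

lemma crossed_eq_sum: "a = (\<Sum>w\<in>UNIV. embed (coeff a w) * hat w)"
proof (rule crossed_eqI)
  fix w
  have coeff_sum: "coeff (sum f S) w = (\<Sum>x\<in>S. coeff (f x) w)" for f :: "'c \<Rightarrow> ('a, 'b) crossed" and S
    by (induction S rule: infinite_finite_induct) (simp_all add: zero_crossed.rep_eq plus_crossed.rep_eq)
  have "coeff (embed A * hat v) w = (if v = w then A else 0)" for A :: "('a, 'b) diffop_matrix" and v
  proof -
    have "(if u = 1 then A else 0) ** hat_action u (if inverse u * w = v then mat 1 else 0) =
      (if u = 1 then if v = w then A else 0 else 0)" for u
      by (auto simp: matrix_mult_0_left matrix_mult_0_right matrix_mul_rid hat_action_1 perm_inverse_times_eq)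
    thus ?thesis by (simp add: embed.rep_eq hat.rep_eq times_crossed.rep_eq)
  qed
  thus "coeff a w = coeff (\<Sum>w\<in>UNIV. embed (coeff a w) * hat w) w"
    by (simp add: coeff_sum)
qed

lemma hat_action_mat:
  "hat_action w (mat D :: ('n::finite, 'd::finite) diffop_matrix) = mat (perm_diffop w D)"
proof -
  have "((\<lambda>k. p (w \<langle>$\<rangle> k)) = (\<lambda>k. q (w \<langle>$\<rangle> k))) = (p = q)" for p q :: "'n \<Rightarrow> 'd"
    by (metis apply_inverse_apply(2) ext)
  thus ?thesis by (simp add: vec_eq_iff hat_action_entry mat_def perm_diffop_0)
qed

lemma scalar_central: "scalar c * a = a * scalar c"
proof -
  have "scalar c * (embed A * hat w) = embed A * hat w * scalar c" for A :: "('a, 'b) diffop_matrix" and w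
  proof -
    have "mat (mult_op (const_mero c)) ** A = A ** mat (mult_op (const_mero c))"
      by (simp add: vec_eq_iff mat_mult_left mat_mult_right mult_op_const_mero_central)
    hence "scalar c * embed A = embed A * scalar c"
      by (simp add: scalar_def flip: embed_mult)
    moreover have "hat w * scalar c = scalar c * hat w"
      by (simp add: scalar_def hat_embed hat_action_mat perm_diffop_mult_op perm_const_mero)
    ultimately show ?thesis by (metis mult.assoc)
  qed
  thus ?thesis
    by (subst (1 2) crossed_eq_sum[of a]) (simp only: sum_distrib_left sum_distrib_right)
qed

section \<open>Generic points and functions of coordinate differences\<close>

text \<open>A surjective linear map is open, so the preimage of a dense set is dense.\<close>

lemma generically_linear:
  fixes L :: "'a::euclidean_space \<Rightarrow> 'b::euclidean_space"
  assumes "linear L" "surj L" "generically P"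
  shows "generically (\<lambda>x. P (L x))"
proof -
  obtain D where D: "open D" "closure D = UNIV" "\<forall>x\<in>D. P x"
    using assms(3) unfolding generically_def by blast
  have "open (L -` D)"
    by (intro open_vimage D linear_continuous_on linear_conv_bounded_linear[THEN iffD1, OF assms(1)])
  moreover have "closure (L -` D) = UNIV"
  proof (rule ccontr)
    assume ne: "closure (L -` D) \<noteq> UNIV"
    define T where "T = - closure (L -` D)"
    have "open (L ` T)"
      unfolding T_def by (intro open_surjective_linear_image assms) auto
    moreover have "L ` T \<noteq> {}" using ne by (auto simp: T_def)
    ultimately have "L ` T \<inter> D \<noteq> {}"
      using D(2) open_Int_closure_eq_empty[of "L ` T" D] by simp
    moreover have "T \<inter> L -` D = {}"
      using closure_subset[of "L -` D"] by (auto simp: T_def)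
    ultimately show False by auto
  qed
  ultimately show ?thesis
    unfolding generically_def using D(3) by (intro exI[of _ "L -` D"]) auto
qed

lemma generically_coord_diff:
  fixes i j :: "'n::finite"
  assumes "i \<noteq> j" "generically P"
  shows "generically (\<lambda>x::complex ^ 'n. P (x $ i - x $ j))"
proof (rule generically_linear[where L = "\<lambda>x::complex ^ 'n. x $ i - x $ j"])
  show "linear (\<lambda>x::complex ^ 'n. x $ i - x $ j)"
    by (rule linearI) (auto simp: algebra_simps)
  show "surj (\<lambda>x::complex ^ 'n. x $ i - x $ j)"
  proof (rule surjI)
    show "axis i c $ i - axis i c $ j = c" for c :: complex
      using assms(1) by (simp add: axis_def)
  qed
qed (rule assms(2))

text \<open>This turns a generic identity into an identity at a given point, which may lie on any exceptional set.\<close>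

lemma generically_eq_imp_eq:
  fixes f g :: "'a::t2_space \<Rightarrow> 'b::real_normed_vector"
  assumes "generically (\<lambda>x. f x = g x)" "isCont f a" "isCont g a"
  shows "f a = g a"
proof (rule ccontr)
  assume "f a \<noteq> g a"
  moreover have "isCont (\<lambda>x. f x - g x) a"
    using assms(2,3) by (rule continuous_diff)
  ultimately have "\<forall>\<^sub>F x in nhds a. f x - g x \<noteq> 0"
    unfolding continuous_at by (intro tendsto_imp_eventually_ne) (auto simp: tendsto_nhds_iff continuous_at)
  then obtain T where T: "open T" "a \<in> T" "\<forall>x\<in>T. f x \<noteq> g x"
    unfolding eventually_nhds by auto
  obtain D where D: "open D" "closure D = UNIV" "\<forall>x\<in>D. f x = g x"
    using assms(1) unfolding generically_def by blast
  have "T \<inter> D \<noteq> {}"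
    using T D(2) open_Int_closure_eq_empty[of T D] by auto
  thus False using T D by auto
qed

lemma holo_on_coord_diff:
  fixes i j :: "'n::finite"
  assumes "h holomorphic_on B" "open B"
  shows "holo_on (\<lambda>x::complex ^ 'n. h (x $ i - x $ j)) {x. x $ i - x $ j \<in> B}"
  unfolding holo_on_def
proof
  fix x :: "complex ^ 'n" assume x: "x \<in> {x. x $ i - x $ j \<in> B}"
  let ?d = "deriv h (x $ i - x $ j)"
  have "(h has_derivative (*) ?d) (at (x $ i - x $ j))"
    using holomorphic_derivI[OF assms, of "x $ i - x $ j" UNIV] x by (simp add: has_field_derivative_def)
  moreover have "((\<lambda>x::complex ^ 'n. x $ i - x $ j) has_derivative (\<lambda>v. v $ i - v $ j)) (at x)"
    by (intro has_derivative_diff bounded_linear_imp_has_derivative bounded_linear_vec_nth)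
  ultimately have "((\<lambda>x::complex ^ 'n. h (x $ i - x $ j)) has_derivative (\<lambda>v. ?d * (v $ i - v $ j))) (at x)"
    using has_derivative_compose by blast
  thus "\<exists>f'. ((\<lambda>x::complex ^ 'n. h (x $ i - x $ j)) has_derivative f') (at x) \<and> (\<forall>c v. f' (c *s v) = c * f' v)"
    by (intro exI conjI) (auto simp: algebra_simps)
qed

text \<open>The quotient comes from the Laurent expansion at \<open>z\<close>. The value of \<open>f\<close> at \<open>z\<close> itself is arbitrary, so
  the denominator is made to vanish there.\<close>

lemma meromorphic_local_quotient:
  assumes "f meromorphic_on {z}"
  obtains B p q where "open B" "z \<in> B" "p holomorphic_on B" "q holomorphic_on B"
    "\<And>w. w \<in> B - {z} \<Longrightarrow> q w \<noteq> 0 \<and> f w = p w / q w" "q z = 0"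
proof -
  obtain F where F: "(\<lambda>w. f (z + w)) has_laurent_expansion F"
    using assms unfolding meromorphic_on_def by auto
  define h where "h = eval_fps (fls_base_factor_to_fps F)"
  define a where "a = nat (fls_subdegree F)"
  define b where "b = nat (- fls_subdegree F)"
  have "eventually (\<lambda>w. ereal (norm w) < fls_conv_radius F) (nhds 0)"
  proof -
    have "eventually (\<lambda>w. w \<in> eball 0 (fls_conv_radius F)) (nhds 0)"
      using F by (intro eventually_nhds_in_open) (auto simp: has_laurent_expansion_def zero_ereal_def in_eball_iff)
    thus ?thesis by eventually_elim (simp add: in_eball_iff)
  qed
  moreover have "eventually (\<lambda>w. w \<noteq> 0 \<longrightarrow> eval_fls F w = f (z + w)) (nhds 0)"
    using F by (simp add: has_laurent_expansion_def eventually_at_filter)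
  ultimately have "eventually (\<lambda>w. ereal (norm w) < fls_conv_radius F \<and> (w \<noteq> 0 \<longrightarrow> eval_fls F w = f (z + w))) (nhds 0)"
    by (rule eventually_conj)
  then obtain r where r0: "r > 0"
    "\<forall>w. dist w 0 < r \<longrightarrow> ereal (norm w) < fls_conv_radius F \<and> (w \<noteq> 0 \<longrightarrow> eval_fls F w = f (z + w))"
    unfolding eventually_nhds_metric by blast
  hence r: "r > 0" "\<And>w. cmod w < r \<Longrightarrow> ereal (norm w) < fls_conv_radius F"
    "\<And>w. norm w < r \<Longrightarrow> w \<noteq> 0 \<Longrightarrow> eval_fls F w = f (z + w)"
    by simp_all
  have hol: "(\<lambda>w. h (w - z)) holomorphic_on ball z r"
  proof -
    have "h holomorphic_on ball 0 r"
      unfolding h_def by (intro holomorphic_on_eval_fps)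
        (use r(2) in \<open>auto simp: in_eball_iff fls_conv_radius_altdef\<close>)
    hence "(h \<circ> (\<lambda>w. w - z)) holomorphic_on ball z r"
      by (intro holomorphic_on_compose_gen[where t = "ball 0 r"] holomorphic_intros)
         (auto simp: dist_norm norm_minus_commute)
    thus ?thesis by (simp add: o_def)
  qed
  show ?thesis
  \<comment> \<open>Numerator and denominator get an extra factor $w - z$, so that the denominator vanishes
    at $z$ even if $f$ has no pole there.\<close>
  proof (rule that[of "ball z r" "\<lambda>w. h (w - z) * (w - z) ^ a * (w - z)" "\<lambda>w. (w - z) ^ b * (w - z)"])
    fix w assume w: "w \<in> ball z r - {z}"
    hence nz: "w - z \<noteq> 0" by auto
    have "f w = h (w - z) * (w - z) powi fls_subdegree F"
      using r(3)[of "w - z"] w by (simp add: eval_fls_def h_def dist_norm norm_minus_commute)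
    moreover have "(w - z) powi fls_subdegree F = (w - z) ^ a / (w - z) ^ b"
      using nz by (cases "fls_subdegree F \<ge> 0") (simp_all add: a_def b_def power_int_def power_inverse field_simps)
    ultimately show "(w - z) ^ b * (w - z) \<noteq> 0 \<and>
        f w = h (w - z) * (w - z) ^ a * (w - z) / ((w - z) ^ b * (w - z))"
      using nz by simp
  qed (use r(1) in \<open>auto intro!: holomorphic_intros hol\<close>)
qed

lemma mero_fun_coord_diff:
  fixes i j :: "'n::finite"
  assumes f: "f meromorphic_on UNIV" and ij: "i \<noteq> j"
  shows "mero_fun (\<lambda>x::complex ^ 'n. f (x $ i - x $ j))"
proof (rule mero_funI2)
  fix x :: "complex ^ 'n"
  let ?L = "\<lambda>x::complex ^ 'n. x $ i - x $ j"
  obtain B p q where B: "open B" "?L x \<in> B" "p holomorphic_on B" "q holomorphic_on B"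
    "\<And>w. w \<in> B - {?L x} \<Longrightarrow> q w \<noteq> 0 \<and> f w = p w / q w" "q (?L x) = 0"
    using meromorphic_local_quotient[OF meromorphic_on_subset[OF f]] by (metis subset_UNIV)
  have "generically (\<lambda>z. z \<noteq> ?L x)"
    unfolding generically_def
    by (intro exI[of _ "- {?L x}"]) (auto simp: closure_interior)
  hence "generically (\<lambda>y. ?L y \<noteq> ?L x)"
    by (rule generically_coord_diff[OF ij])
  then obtain D where D: "open D" "closure D = UNIV" "\<forall>y\<in>D. ?L y \<noteq> ?L x"
    unfolding generically_def by blast
  have oN: "open {y. ?L y \<in> B}"
  proof -
    have "continuous_on UNIV ?L" by (intro continuous_intros)
    from open_vimage[OF B(1) this] show ?thesis by (simp add: vimage_def)
  qed
  have "{y. ?L y \<in> B} \<subseteq> closure ({y. ?L y \<in> B} \<inter> D)"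
    using dense_open_Int[OF oN oN closure_subset, of D] D(2) by simp
  also have "\<dots> \<subseteq> closure {y \<in> {y. ?L y \<in> B}. q (?L y) \<noteq> 0}"
    using D(3) B(5) by (intro closure_mono) auto
  finally have "{y. ?L y \<in> B} \<subseteq> closure {y \<in> {y. ?L y \<in> B}. q (?L y) \<noteq> 0}" .
  moreover have "f (?L y) = p (?L y) / q (?L y)" if "?L y \<in> B" "q (?L y) \<noteq> 0" for y
    using B(5,6) that by (cases "?L y = ?L x") auto
  ultimately show "\<exists>N p q. open N \<and> x \<in> N \<and> holo_on p N \<and> holo_on q N \<and> N \<subseteq> closure {y \<in> N. q y \<noteq> 0} \<and>
      (\<forall>y\<in>N. q y \<noteq> 0 \<longrightarrow> f (?L y) = p y / q y)"
    using oN B(2) holo_on_coord_diff[OF B(3,1)] holo_on_coord_diff[OF B(4,1)]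
    by (intro exI[of _ "{y. ?L y \<in> B}"] exI[of _ "\<lambda>y. p (?L y)"] exI[of _ "\<lambda>y. q (?L y)"]) auto
qed

section \<open>Operators on tensor factors\<close>

text \<open>The operator that acts on the tensor factors with indices in the range of the injection \<open>e\<close> as \<open>X\<close> acts on a tensor power
  indexed by \<open>'m\<close>, and as the identity on the others.
  It carries identities between operators on three factors, such as the
  Yang--Baxter equation, to any three factors of $U$.\<close>

definition lift_factors ::
  "('m::finite \<Rightarrow> 'n::finite) \<Rightarrow> 'a::zero ^ ('m \<Rightarrow> 'd::finite) ^ ('m \<Rightarrow> 'd) \<Rightarrow> 'a ^ ('n \<Rightarrow> 'd) ^ ('n \<Rightarrow> 'd)" where
  "lift_factors e X =
     (\<chi> p q. if \<forall>k. k \<notin> range e \<longrightarrow> p k = q k then X $ (\<lambda>a. p (e a)) $ (\<lambda>a. q (e a)) else 0)"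

lemma lift_factors_add: "lift_factors e (X + Y) = lift_factors e X + (lift_factors e Y :: 'a::monoid_add ^ _ ^ _)"
  by (auto simp: lift_factors_def vec_eq_iff)

lemma on_factors_eq_lift_factors:
  assumes "inj e"
  shows "on_factors (e a) (e b) A = lift_factors e (on_factors a b A)"
proof -
  have support: "(\<forall>k. k \<noteq> e a \<and> k \<noteq> e b \<longrightarrow> p k = q k) \<longleftrightarrow>
      (\<forall>k. k \<notin> range e \<longrightarrow> p k = q k) \<and> (\<forall>c. c \<noteq> a \<and> c \<noteq> b \<longrightarrow> p (e c) = q (e c))"
    (is "?L p q \<longleftrightarrow> ?R p q") for p q
  proof
    assume L: "?L p q"
    have "p k = q k" if "k \<notin> range e" for k
      using L that by blast
    thus "?R p q" using L inj_eq[OF assms] by auto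
  next
    assume R: "?R p q"
    show "?L p q"
    proof (intro allI impI)
      fix k assume "k \<noteq> e a \<and> k \<noteq> e b"
      thus "p k = q k" using R by (cases "k \<in> range e") auto
    qed
  qed
  show ?thesis
    by (simp only: lift_factors_def on_factors_def vec_eq_iff vec_lambda_beta support) auto
qed

text \<open>Both operators preserve the indices outside the range of \<open>e\<close>, so in the sum over intermediate basis vectors only those
  remain that agree with \<open>p\<close> there; they correspond to the basis vectors of the tensor power indexed by \<open>'m\<close>.\<close>

lemma lift_factors_mult:
  fixes X Y :: "'a::semiring_1 ^ ('m::finite \<Rightarrow> 'd::finite) ^ ('m \<Rightarrow> 'd)" and e :: "'m \<Rightarrow> 'n::finite"
  assumes e: "inj e"
  shows "lift_factors e (X ** Y) = lift_factors e X ** lift_factors e Y"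
proof -
  have "lift_factors e (X ** Y) $ p $ q = (lift_factors e X ** lift_factors e Y) $ p $ q" for p q
  proof (cases "\<forall>k. k \<notin> range e \<longrightarrow> p k = q k")
    case True
    let ?r = "\<lambda>s k. if k \<in> range e then s (inv e k) else p k"
    let ?S = "{r. \<forall>k. k \<notin> range e \<longrightarrow> p k = r k}"
    have "(lift_factors e X ** lift_factors e Y) $ p $ q =
        (\<Sum>r\<in>?S. X $ (\<lambda>a. p (e a)) $ (\<lambda>a. r (e a)) * Y $ (\<lambda>a. r (e a)) $ (\<lambda>a. q (e a)))"
      unfolding matrix_matrix_mult_def lift_factors_def vec_lambda_beta
    proof (rule sum.mono_neutral_cong_right)
      show "\<forall>r\<in>UNIV - ?S. (if \<forall>k. k \<notin> range e \<longrightarrow> p k = r k then X $ (\<lambda>a. p (e a)) $ (\<lambda>a. r (e a)) else 0) *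
          (if \<forall>k. k \<notin> range e \<longrightarrow> r k = q k then Y $ (\<lambda>a. r (e a)) $ (\<lambda>a. q (e a)) else 0) = 0"
        by auto
    qed (use True in auto)
    also have "\<dots> = (\<Sum>s\<in>UNIV. X $ (\<lambda>a. p (e a)) $ s * Y $ s $ (\<lambda>a. q (e a)))"
      by (rule sum.reindex_bij_witness[of _ ?r "\<lambda>r a. r (e a)"]) (use e in \<open>auto simp: fun_eq_iff\<close>)
    finally show ?thesis
      using True by (simp add: lift_factors_def matrix_matrix_mult_def)
  next
    case False
    then obtain k where "k \<notin> range e" "p k \<noteq> q k" by blast
    hence "lift_factors e X $ p $ r * lift_factors e Y $ r $ q = 0" for r
      by (auto simp: lift_factors_def)
    thus ?thesis using False by (auto simp: lift_factors_def matrix_matrix_mult_def)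
  qed
  thus ?thesis by (simp add: vec_eq_iff)
qed

lemma flip_conjugate_entry:
  fixes A :: "complex ^ ('d::finite \<times> 'd) ^ ('d \<times> 'd)"
  shows "(flip ** A ** flip) $ (a, b) $ (c, d) = A $ (b, a) $ (d, c)"
proof -
  have "flip $ p $ q = (if q = (snd p, fst p) then 1 else 0)"
    "flip $ p $ q = (if p = (snd q, fst q) then 1 else 0)" for p q :: "'d \<times> 'd"
    by (auto simp: flip_def)
  from this(1)[of "(a, b)"] this(2)[of _ "(c, d)"] show ?thesis
    by (simp add: matrix_matrix_mult_def if_distrib[of "\<lambda>x. x * _"] if_distrib[of "\<lambda>x. _ * x"] cong: if_cong)
qed

lemma on_factors_flip: "on_factors i j (flip ** A ** flip) = on_factors j i A"
  by (auto simp: on_factors_def vec_eq_iff flip_conjugate_entry)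

lemma on_factors_uminus: "on_factors i j (- A) = - on_factors i j A"
  by (auto simp: on_factors_def vec_eq_iff)

text \<open>Only one intermediate basis vector contributes: the one with the entries of \<open>q\<close> at \<open>i\<close> and \<open>j\<close>, where the
  first operator acts, and those of \<open>p\<close> elsewhere. The resulting formula is symmetric in the two operators.\<close>

lemma on_factors_mult_disjoint:
  assumes "distinct [i, j, k, l]"
  shows "(on_factors i j A ** on_factors k l B) $ p $ q =
    (if \<forall>m. m \<notin> {i, j, k, l} \<longrightarrow> p m = q m then A $ (p i, p j) $ (q i, q j) * B $ (p k, p l) $ (q k, q l) else 0)"
proof -
  let ?r = "\<lambda>m. if m = i \<or> m = j then q m else p m"
  have "on_factors i j A $ p $ r * on_factors k l B $ r $ q = 0" if "r \<noteq> ?r" for r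
  proof (rule ccontr)
    assume nz: "\<not> ?thesis"
    have "\<forall>m. m \<noteq> i \<and> m \<noteq> j \<longrightarrow> p m = r m" "\<forall>m. m \<noteq> k \<and> m \<noteq> l \<longrightarrow> r m = q m"
      using nz by (auto simp: on_factors_def split: if_splits)
    hence "r = ?r" using assms by (auto simp: fun_eq_iff)
    thus False using that by simp
  qed
  hence "(\<Sum>r\<in>UNIV. on_factors i j A $ p $ r * on_factors k l B $ r $ q) =
      (\<Sum>r\<in>{?r}. on_factors i j A $ p $ r * on_factors k l B $ r $ q)"
    by (intro sum.mono_neutral_right) auto
  thus ?thesis
    using assms by (auto simp: matrix_matrix_mult_def on_factors_def)
qed

lemma on_factors_commute:
  assumes "distinct [i, j, k, l]"
  shows "on_factors i j A ** on_factors k l B = on_factors k l B ** on_factors i j A"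
proof -
  have kl: "distinct [k, l, i, j]" and same: "{k, l, i, j} = {i, j, k, l}"
    using assms by auto
  have "(on_factors i j A ** on_factors k l B) $ p $ q = (on_factors k l B ** on_factors i j A) $ p $ q" for p q
    unfolding on_factors_mult_disjoint[OF assms] on_factors_mult_disjoint[OF kl] same
    by (simp only: mult.commute)
  thus ?thesis by (simp add: vec_eq_iff)
qed

section \<open>Identities for fixed spectral parameters\<close>

definition holo_at :: "'d::finite rmatrix \<Rightarrow> complex \<Rightarrow> complex \<Rightarrow> bool" where
  "holo_at R z \<mu> \<longleftrightarrow> (\<exists>N. open N \<and> vector [z, \<mu>] \<in> N \<and> (\<forall>p q. holo_on (rmatrix_entry R p q) N))"

lemma isCont_matrix_iff: "isCont F a \<longleftrightarrow> (\<forall>p q. isCont (\<lambda>x. F x $ p $ q) a)"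
  for F :: "'a::t2_space \<Rightarrow> 'b::real_normed_vector ^ 'k::finite ^ 'm::finite"
proof
  show "\<forall>p q. isCont (\<lambda>x. F x $ p $ q) a" if "isCont F a"
    using that unfolding isCont_def by (intro allI tendsto_vec_nth)
  show "isCont F a" if "\<forall>p q. isCont (\<lambda>x. F x $ p $ q) a"
    using that unfolding isCont_def by (intro vec_tendstoI) blast
qed

lemma isCont_matrix_mult:
  fixes F G :: "'a::t2_space \<Rightarrow> complex ^ 'k::finite ^ 'k"
  assumes "isCont F a" "isCont G a"
  shows "isCont (\<lambda>x. F x ** G x) a"
proof -
  have "isCont (\<lambda>x. \<Sum>r\<in>UNIV. F x $ p $ r * G x $ r $ q) a" for p q
    using assms by (intro continuous_sum continuous_mult) (simp_all add: isCont_matrix_iff)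
  thus ?thesis
    by (simp add: isCont_matrix_iff matrix_matrix_mult_def)
qed

lemma isCont_on_factors:
  fixes F :: "'a::t2_space \<Rightarrow> complex ^ ('d::finite \<times> 'd) ^ ('d \<times> 'd)" and i j :: "'m::finite"
  assumes F: "isCont F a"
  shows "isCont (\<lambda>x. on_factors i j (F x)) a"
proof -
  have "isCont (\<lambda>x. on_factors i j (F x) $ p $ q) a" for p q
  proof (cases "\<forall>k. k \<noteq> i \<and> k \<noteq> j \<longrightarrow> p k = q k")
    case True
    hence "(\<lambda>x. on_factors i j (F x) $ p $ q) = (\<lambda>x. F x $ (p i, p j) $ (q i, q j))"
      by (simp add: on_factors_def)
    thus ?thesis using F by (simp only: isCont_matrix_iff)
  next
    case False
    hence "(\<lambda>x. on_factors i j (F x) $ p $ q) = (\<lambda>x. 0)"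
      by (intro ext) (auto simp: on_factors_def)
    thus ?thesis by simp
  qed
  thus ?thesis unfolding isCont_matrix_iff by blast
qed

text \<open>In the form needed for the continuity of both sides of an identity whose arguments are
  linear in the independent variables.\<close>

lemma isCont_rmatrix:
  fixes f g :: "'a::t2_space \<Rightarrow> complex"
  assumes "holo_at R (f a) (g a)" "isCont f a" "isCont g a"
  shows "isCont (\<lambda>x. R (f x) (g x)) a"
proof -
  obtain N where N: "open N" "vector [f a, g a] \<in> N" "\<And>p q. holo_on (rmatrix_entry R p q) N"
    using assms(1) unfolding holo_at_def by blast
  have c: "isCont (\<lambda>x. vector [f x, g x] :: complex ^ 2) a"
    unfolding isCont_def
  proof (rule vec_tendstoI)
    fix b :: 2
    show "(\<lambda>x. vector [f x, g x] $ b) \<midarrow>a\<rightarrow> vector [f a, g a] $ b"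
      using assms(2,3) exhaust_2[of b] by (auto simp: isCont_def)
  qed
  have "isCont (\<lambda>x. R (f x) (g x) $ p $ q) a" for p q
  proof -
    have "isCont (rmatrix_entry R p q) (vector [f a, g a])"
      using holo_on_imp_continuous_on[OF N(3)] N(1,2) continuous_on_eq_continuous_at by blast
    from isCont_o2[OF c this] show ?thesis by (simp add: rmatrix_entry_def)
  qed
  thus ?thesis unfolding isCont_matrix_iff by blast
qed

lemma skew_symmetric_at:
  assumes "skew_symmetric R" "holo_at R z \<mu>" "holo_at R (- z) (- \<mu>)"
  shows "R (- z) (- \<mu>) = - (flip ** R z \<mu> ** flip)"
proof -
  have "generically (\<lambda>v. R (- fst v) (- snd v) = - (flip ** R (fst v) (snd v) ** flip))"
    using assms(1) unfolding skew_symmetric_def by (rule generically_mono) auto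
  moreover have "isCont (\<lambda>v. R (- fst v) (- snd v)) (z, \<mu>)"
    by (intro isCont_rmatrix[where R = R] continuous_intros) (use assms(3) in simp)
  moreover have "isCont (\<lambda>v. - (flip ** R (fst v) (snd v) ** flip)) (z, \<mu>)"
    by (intro continuous_minus isCont_matrix_mult isCont_rmatrix[where R = R] continuous_intros) (use assms(2) in simp)
  ultimately show ?thesis
    using generically_eq_imp_eq[of "\<lambda>v. R (- fst v) (- snd v)" _ "(z, \<mu>)"] by fastforce
qed

text \<open>Continuity extends the equation from generic arguments to these, and lifting along $1 \mapsto i$, $2 \mapsto j$, $3 \mapsto k$
  moves it to the chosen factors of $U$.\<close>

lemma associative_YBE_at:
  fixes R :: "'d::finite rmatrix" and i j k :: "'n::finite"
  assumes ybe: "associative_YBE R" and ne: "distinct [i, j, k]"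
    and hol: "holo_at R z \<mu>" "holo_at R z' \<mu>'" "holo_at R (z + z') \<mu>'" "holo_at R z (\<mu> - \<mu>')"
      "holo_at R z' (\<mu>' - \<mu>)" "holo_at R (z + z') \<mu>"
  shows "on_factors i j (R z \<mu>) ** on_factors j k (R z' \<mu>') =
     on_factors i k (R (z + z') \<mu>') ** on_factors i j (R z (\<mu> - \<mu>')) +
     on_factors j k (R z' (\<mu>' - \<mu>)) ** on_factors i k (R (z + z') \<mu>)"
proof -
  define F G :: "complex \<times> complex \<times> complex \<times> complex \<Rightarrow> complex ^ (3 \<Rightarrow> 'd) ^ (3 \<Rightarrow> 'd)"
    where "F = (\<lambda>v. on_factors 1 2 (R (fst v) (fst (snd v))) **
             on_factors 2 3 (R (fst (snd (snd v))) (snd (snd (snd v)))))"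
      and "G = (\<lambda>v. on_factors 1 3 (R (fst v + fst (snd (snd v))) (snd (snd (snd v)))) **
             on_factors 1 2 (R (fst v) (fst (snd v) - snd (snd (snd v)))) +
             on_factors 2 3 (R (fst (snd (snd v))) (snd (snd (snd v)) - fst (snd v))) **
             on_factors 1 3 (R (fst v + fst (snd (snd v))) (fst (snd v))))"
  have "generically (\<lambda>v. F v = G v)"
    using ybe unfolding associative_YBE_def Let_def by (rule generically_mono) (auto simp: F_def G_def)
  moreover have "isCont F (z, \<mu>, z', \<mu>')"
    unfolding F_def
    by (intro isCont_matrix_mult isCont_on_factors isCont_rmatrix[where R = R] continuous_intros)
       (use hol in simp_all)
  moreover have "isCont G (z, \<mu>, z', \<mu>')"
    unfolding G_def
    by (intro continuous_add isCont_matrix_mult isCont_on_factors isCont_rmatrix[where R = R] continuous_intros)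
       (use hol in simp_all)
  ultimately have "F (z, \<mu>, z', \<mu>') = G (z, \<mu>, z', \<mu>')"
    by (rule generically_eq_imp_eq)
  hence three: "on_factors (1::3) 2 (R z \<mu>) ** on_factors 2 3 (R z' \<mu>') =
     on_factors 1 3 (R (z + z') \<mu>') ** on_factors 1 2 (R z (\<mu> - \<mu>')) +
     on_factors 2 3 (R z' (\<mu>' - \<mu>)) ** on_factors 1 3 (R (z + z') \<mu>)"
    by (simp add: F_def G_def)
  define e :: "3 \<Rightarrow> 'n" where "e = (\<lambda>a. if a = 1 then i else if a = 2 then j else k)"
  have e: "inj e" "e 1 = i" "e 2 = j" "e 3 = k"
    using ne exhaust_3 by (auto simp: e_def inj_on_def split: if_splits)
  show ?thesis
    using arg_cong[OF three, of "lift_factors e"]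
    by (simp add: lift_factors_mult lift_factors_add e(1) e(2-4) flip: on_factors_eq_lift_factors[OF e(1)])
qed

section \<open>The operators $R_{ij}(x_i - x_j, \mu)$\<close>

lemma generically_holo_at_coord_diff:
  fixes i j :: "'n::finite"
  assumes "spectral_value R \<mu>" "i \<noteq> j"
  shows "generically (\<lambda>x::complex ^ 'n. holo_at R (x $ i - x $ j) \<mu>)"
  using assms(1) generically_coord_diff[OF assms(2), of "\<lambda>z. holo_at R z \<mu>"]
  by (simp add: spectral_value_def holo_at_def)

text \<open>Without this, \<open>abs_mero\<close> in the definition of the factors $R_{ij}$ would have an unspecified value.\<close>

lemma mero_matrix_R_factor:
  fixes i j :: "'n::finite"
  assumes "spectral_value R \<mu>" "i \<noteq> j"
  shows "mero_matrix (\<lambda>x::complex ^ 'n. on_factors i j (R (x $ i - x $ j) \<mu>))"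
  unfolding mero_matrix_def
proof (intro allI)
  fix p q :: "'n \<Rightarrow> 'a"
  have "mero_fun (\<lambda>x::complex ^ 'n. R (x $ i - x $ j) \<mu> $ (p i, p j) $ (q i, q j))"
    using assms(1) by (intro mero_fun_coord_diff assms(2)) (simp add: spectral_value_def)
  moreover have "mero_fun (\<lambda>x. if c then f x else 0)" if "mero_fun f" for c and f :: "complex ^ 'n \<Rightarrow> complex"
    using that by (cases c) (simp_all add: mero_fun_const)
  ultimately show "mero_fun (\<lambda>x::complex ^ 'n. on_factors i j (R (x $ i - x $ j) \<mu>) $ p $ q)"
    by (simp only: on_factors_def vec_lambda_beta)
qed

lemma R_factor_eq_mult_matrix:
  "R_factor R i j \<mu> = mult_matrix (\<lambda>x. on_factors i j (R (x $ i - x $ j) \<mu>))"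
  by (simp add: R_factor_def mult_matrix_def)

lemma R_factor_skew:
  fixes i j :: "'n::finite"
  assumes skew: "skew_symmetric R" and sv: "spectral_value R \<mu>" "spectral_value R (- \<mu>)" and ij: "i \<noteq> j"
  shows "R_factor R j i (- \<mu>) = - R_factor R i j \<mu>"
proof -
  have "generically (\<lambda>x::complex ^ 'n. on_factors j i (R (x $ j - x $ i) (- \<mu>)) = - on_factors i j (R (x $ i - x $ j) \<mu>))"
  proof (rule generically_conj_imp[OF generically_holo_at_coord_diff[OF sv(1) ij]
        generically_holo_at_coord_diff[OF sv(2) ij[symmetric]]])
    fix x :: "complex ^ 'n"
    assume "holo_at R (x $ i - x $ j) \<mu>" "holo_at R (x $ j - x $ i) (- \<mu>)"
    thus "on_factors j i (R (x $ j - x $ i) (- \<mu>)) = - on_factors i j (R (x $ i - x $ j) \<mu>)"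
      using skew_symmetric_at[OF skew, of "x $ i - x $ j" \<mu>] by (simp add: on_factors_uminus on_factors_flip)
  qed
  thus ?thesis
    using ij sv by (simp add: R_factor_eq_mult_matrix mero_matrix_R_factor mero_matrix_uminus
        mult_matrix_cong[of _ "\<lambda>x. - on_factors i j (R (x $ i - x $ j) \<mu>)"] flip: mult_matrix_uminus)
qed

lemma R_factor_associative_YBE:
  fixes i j k :: "'n::finite"
  assumes ybe: "associative_YBE R" and ne: "distinct [i, j, k]"
    and sv: "spectral_value R \<mu>" "spectral_value R \<mu>'" "spectral_value R (\<mu> - \<mu>')" "spectral_value R (\<mu>' - \<mu>)"
  shows "R_factor R i j \<mu> ** R_factor R j k \<mu>' =
    R_factor R i k \<mu>' ** R_factor R i j (\<mu> - \<mu>') + R_factor R j k (\<mu>' - \<mu>) ** R_factor R i k \<mu>"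
proof -
  let ?R = "\<lambda>i j \<mu> (x::complex ^ 'n). on_factors i j (R (x $ i - x $ j) \<mu>)"
  have ij: "i \<noteq> j" and jk: "j \<noteq> k" and ik: "i \<noteq> k" using ne by auto
  note gen = generically_holo_at_coord_diff
  have "generically (\<lambda>x. (((holo_at R (x $ i - x $ j) \<mu> \<and> holo_at R (x $ j - x $ k) \<mu>') \<and>
      holo_at R (x $ i - x $ k) \<mu>') \<and> holo_at R (x $ i - x $ j) (\<mu> - \<mu>')) \<and>
      holo_at R (x $ j - x $ k) (\<mu>' - \<mu>) \<and> holo_at R (x $ i - x $ k) \<mu>)"
    by (intro generically_conj gen sv ij jk ik)
  hence eq: "generically (\<lambda>x. ?R i j \<mu> x ** ?R j k \<mu>' x =
      ?R i k \<mu>' x ** ?R i j (\<mu> - \<mu>') x + ?R j k (\<mu>' - \<mu>) x ** ?R i k \<mu> x)"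
  proof (rule generically_mono)
    fix x :: "complex ^ 'n"
    assume "(((holo_at R (x $ i - x $ j) \<mu> \<and> holo_at R (x $ j - x $ k) \<mu>') \<and>
      holo_at R (x $ i - x $ k) \<mu>') \<and> holo_at R (x $ i - x $ j) (\<mu> - \<mu>')) \<and>
      holo_at R (x $ j - x $ k) (\<mu>' - \<mu>) \<and> holo_at R (x $ i - x $ k) \<mu>"
    thus "?R i j \<mu> x ** ?R j k \<mu>' x = ?R i k \<mu>' x ** ?R i j (\<mu> - \<mu>') x + ?R j k (\<mu>' - \<mu>) x ** ?R i k \<mu> x"
      using associative_YBE_at[OF ybe ne, of "x $ i - x $ j" \<mu> "x $ j - x $ k" \<mu>'] by simp
  qed
  have m: "mero_matrix (?R i j \<mu>)" "mero_matrix (?R j k \<mu>')" "mero_matrix (?R i k \<mu>')"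
    "mero_matrix (?R i j (\<mu> - \<mu>'))" "mero_matrix (?R j k (\<mu>' - \<mu>))" "mero_matrix (?R i k \<mu>)"
    by (intro mero_matrix_R_factor sv ij jk ik)+
  from mult_matrix_cong[OF mero_matrix_mult[OF m(1,2)]
      mero_matrix_add[OF mero_matrix_mult[OF m(3,4)] mero_matrix_mult[OF m(5,6)]] eq]
  show ?thesis
    by (simp add: R_factor_eq_mult_matrix mult_matrix_mult mult_matrix_add mero_matrix_mult m)
qed

lemma R_factor_commute:
  fixes i j k l :: "'n::finite"
  assumes "distinct [i, j, k, l]" "spectral_value R \<mu>" "spectral_value R \<nu>"
  shows "R_factor R i j \<mu> ** R_factor R k l \<nu> = R_factor R k l \<nu> ** R_factor R i j \<mu>"
  unfolding R_factor_eq_mult_matrix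
  using assms by (simp add: mero_matrix_R_factor on_factors_commute[OF assms(1)] flip: mult_matrix_mult)

lemma hat_action_R_factor:
  fixes i j :: "'n::finite"
  assumes "spectral_value R \<mu>" "i \<noteq> j"
  shows "hat_action w (R_factor R i j \<mu>) = R_factor R (w \<langle>$\<rangle> i) (w \<langle>$\<rangle> j) \<mu>"
proof -
  have "(\<forall>k. k \<noteq> i \<and> k \<noteq> j \<longrightarrow> p (w \<langle>$\<rangle> k) = q (w \<langle>$\<rangle> k)) \<longleftrightarrow>
      (\<forall>k. k \<noteq> w \<langle>$\<rangle> i \<and> k \<noteq> w \<langle>$\<rangle> j \<longrightarrow> p k = q k)" for p q :: "'n \<Rightarrow> 'a"
    by (metis apply_inverse_apply)
  hence entry: "on_factors i j A $ (\<lambda>k. p (w \<langle>$\<rangle> k)) $ (\<lambda>k. q (w \<langle>$\<rangle> k)) = on_factors (w \<langle>$\<rangle> i) (w \<langle>$\<rangle> j) A $ p $ q"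
    for p q :: "'n \<Rightarrow> 'a" and A
    by (simp add: on_factors_def)
  have "mero_fun (\<lambda>x::complex ^ 'n. on_factors (w \<langle>$\<rangle> i) (w \<langle>$\<rangle> j) (R (x $ i - x $ j) \<mu>) $ p $ q)" for p q
    using mero_matrixD[OF mero_matrix_R_factor[OF assms], of "\<lambda>k. p (w \<langle>$\<rangle> k)" "\<lambda>k. q (w \<langle>$\<rangle> k)"]
    by (simp only: entry)
  thus ?thesis
    by (simp add: entry vec_eq_iff hat_action_entry R_factor_def perm_diffop_mult_op perm_abs_mero perm_vec_def)
qed

section \<open>Dunkl operators\<close>

definition exchange_term :: "'d::finite rmatrix \<Rightarrow> complex ^ 'n \<Rightarrow> 'n::finite \<Rightarrow> 'n \<Rightarrow> ('n, 'd) crossed" where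
  "exchange_term R lam i j = embed (R_factor R i j (lam $ i - lam $ j)) * hat \<langle>i \<leftrightarrow> j\<rangle>"

lemma dunkl_coord_eq:
  "dunkl_coord R hbar g lam i =
     scalar hbar * embed (mat (pderiv_op i)) - scalar g * (\<Sum>j\<in>UNIV - {i}. exchange_term R lam i j)"
  by (simp add: dunkl_coord_def exchange_term_def)

text \<open>Conjugation moves the positions \<open>i\<close> and \<open>j\<close> but leaves the spectral parameter alone.\<close>

lemma hat_embed_R_factor:
  assumes "spectral_value R \<mu>" "i \<noteq> j"
  shows "hat w * embed (R_factor R i j \<mu>) = embed (R_factor R (w \<langle>$\<rangle> i) (w \<langle>$\<rangle> j) \<mu>) * hat w"
  using assms by (simp add: hat_embed hat_action_R_factor)

lemma exchange_term_mult:
  fixes lam :: "complex ^ 'n::finite"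
  assumes "spectral_value R (lam $ k - lam $ l)" "k \<noteq> l"
  shows "exchange_term R lam i j * exchange_term R lam k l =
    embed (R_factor R i j (lam $ i - lam $ j) **
      R_factor R (\<langle>i \<leftrightarrow> j\<rangle> \<langle>$\<rangle> k) (\<langle>i \<leftrightarrow> j\<rangle> \<langle>$\<rangle> l) (lam $ k - lam $ l)) * hat (\<langle>i \<leftrightarrow> j\<rangle> * \<langle>k \<leftrightarrow> l\<rangle>)"
proof -
  have "exchange_term R lam i j * exchange_term R lam k l =
      embed (R_factor R i j (lam $ i - lam $ j)) * (hat \<langle>i \<leftrightarrow> j\<rangle> * embed (R_factor R k l (lam $ k - lam $ l))) * hat \<langle>k \<leftrightarrow> l\<rangle>"
    by (simp add: exchange_term_def mult.assoc)
  thus ?thesis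
    by (simp add: hat_embed_R_factor[OF assms] embed_mult mult.assoc hat_mult)
qed

lemma commutator_embed_pderiv_op: "commutator (embed (mat (pderiv_op i))) (embed (mat (pderiv_op j))) = 0"
proof -
  have "mat (pderiv_op i) ** mat (pderiv_op j) = (mat (pderiv_op j) ** mat (pderiv_op i) :: ('a, 'b) diffop_matrix)"
    using commutator_pderiv_op[of i j]
    by (simp add: vec_eq_iff mat_mult_left commutator_def) (simp add: mat_def)
  thus ?thesis by (simp add: commutator_def flip: embed_mult)
qed

lemma invariant_derivative_commutes_exchange_term:
  fixes lam :: "complex ^ 'n::finite"
  assumes sv: "spectral_value R (lam $ j - lam $ k)" and jk: "j \<noteq> k" and S: "j \<in> S \<longleftrightarrow> k \<in> S"
  shows "commutator (embed (mat (\<Sum>l\<in>S. pderiv_op l))) (exchange_term R lam j k) = 0"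
proof -
  let ?D = "mat (\<Sum>l\<in>S. pderiv_op l)" and ?M = "R_factor R j k (lam $ j - lam $ k)"
  have "?D ** ?M = ?M ** ?D"
    unfolding R_factor_eq_mult_matrix
    by (rule invariant_mult_matrix_commutes[OF mero_matrix_R_factor[OF sv jk]]) (use S in simp)
  hence 1: "embed ?D * embed ?M = embed ?M * embed ?D"
    by (simp flip: embed_mult)
  have 2: "hat \<langle>j \<leftrightarrow> k\<rangle> * embed ?D = embed ?D * hat \<langle>j \<leftrightarrow> k\<rangle>"
  proof -
    have "(\<Sum>l\<in>S. pderiv_op (\<langle>j \<leftrightarrow> k\<rangle> \<langle>$\<rangle> l)) = (\<Sum>l\<in>S. pderiv_op l)"
    proof (rule sum.reindex_bij_witness[of _ "\<lambda>l. \<langle>j \<leftrightarrow> k\<rangle> \<langle>$\<rangle> l" "\<lambda>l. \<langle>j \<leftrightarrow> k\<rangle> \<langle>$\<rangle> l"])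
      fix l assume l: "l \<in> S"
      show "\<langle>j \<leftrightarrow> k\<rangle> \<langle>$\<rangle> l \<in> S"
        using S l by (cases "l = j"; cases "l = k") simp_all
      thus "\<langle>j \<leftrightarrow> k\<rangle> \<langle>$\<rangle> l \<in> S" .
      show "\<langle>j \<leftrightarrow> k\<rangle> \<langle>$\<rangle> (\<langle>j \<leftrightarrow> k\<rangle> \<langle>$\<rangle> l) = l"
        using apply_inverse_apply(1)[of "\<langle>j \<leftrightarrow> k\<rangle>" l] by simp
      thus "\<langle>j \<leftrightarrow> k\<rangle> \<langle>$\<rangle> (\<langle>j \<leftrightarrow> k\<rangle> \<langle>$\<rangle> l) = l" .
    qed simp
    thus ?thesis
      by (simp add: hat_embed hat_action_mat perm_diffop_sum perm_diffop_pderiv_op)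
  qed
  have "embed ?D * (embed ?M * hat \<langle>j \<leftrightarrow> k\<rangle>) = embed ?M * hat \<langle>j \<leftrightarrow> k\<rangle> * embed ?D"
    by (simp only: mult.assoc 2) (simp only: 1 flip: mult.assoc)
  thus ?thesis
    by (simp add: commutator_def exchange_term_def)
qed

text \<open>What remains is to verify the hypotheses of \<open>dunkl_type_operators_commute\<close> for the exchange terms.\<close>

lemma dunkl_coord_commute:
  fixes lam :: "complex ^ 'n::finite" and R :: "'d::finite rmatrix"
  assumes skew: "skew_symmetric R" and ybe: "associative_YBE R"
    and sv: "\<And>i j. i \<noteq> j \<Longrightarrow> spectral_value R (lam $ i - lam $ j)"
  shows "commutator (dunkl_coord R hbar g lam i) (dunkl_coord R hbar g lam j) = 0"
  unfolding dunkl_coord_eq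
proof (rule dunkl_type_operators_commute)
  show "commutator (embed (mat (pderiv_op i))) (exchange_term R lam j k) = 0" if "distinct [i, j, k]" for i j k
    using invariant_derivative_commutes_exchange_term[OF sv, of j k "{i}"] that by auto
  show "commutator (embed (mat (pderiv_op i)) + embed (mat (pderiv_op j))) (exchange_term R lam i j) = 0"
    if "i \<noteq> j" for i j
  proof -
    have "embed (mat (pderiv_op i)) + embed (mat (pderiv_op j)) = (embed (mat (\<Sum>l\<in>{i, j}. pderiv_op l)) :: ('n, 'd) crossed)"
      using that by (auto simp: mat_def vec_eq_iff intro!: arg_cong[where f = embed] simp flip: embed_add)
    thus ?thesis
      using invariant_derivative_commutes_exchange_term[OF sv[OF that] that, of "{i, j}"] by simp
  qed
  show "exchange_term R lam j i = - exchange_term R lam i j" if "i \<noteq> j" for i j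
    using R_factor_skew[OF skew sv[OF that], of i j] sv[OF that[symmetric]] that
    by (simp add: exchange_term_def swap_sym[of j i] embed_uminus)
  show "commutator (exchange_term R lam i j) (exchange_term R lam k l) = 0" if ne: "distinct [i, j, k, l]" for i j k l
  proof -
    have "\<langle>i \<leftrightarrow> j\<rangle> * \<langle>k \<leftrightarrow> l\<rangle> = \<langle>k \<leftrightarrow> l\<rangle> * \<langle>i \<leftrightarrow> j\<rangle>"
    proof (rule perm_eqI)
      fix a
      show "(\<langle>i \<leftrightarrow> j\<rangle> * \<langle>k \<leftrightarrow> l\<rangle>) \<langle>$\<rangle> a = (\<langle>k \<leftrightarrow> l\<rangle> * \<langle>i \<leftrightarrow> j\<rangle>) \<langle>$\<rangle> a"
        using ne by (cases "a = i"; cases "a = j"; cases "a = k"; cases "a = l") (auto simp: apply_times)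
    qed
    moreover have "k \<noteq> i" "k \<noteq> j" "l \<noteq> i" "l \<noteq> j" using ne by auto
    ultimately show ?thesis
      using ne by (simp add: commutator_def exchange_term_mult sv R_factor_commute)
  qed
  show "exchange_term R lam i j * exchange_term R lam j k =
      exchange_term R lam i k * exchange_term R lam i j + exchange_term R lam j k * exchange_term R lam i k"
    if ne: "distinct [i, j, k]" for i j k
  proof -
    have cycle: "\<langle>i \<leftrightarrow> k\<rangle> * \<langle>i \<leftrightarrow> j\<rangle> = \<langle>i \<leftrightarrow> j\<rangle> * \<langle>j \<leftrightarrow> k\<rangle>" "\<langle>j \<leftrightarrow> k\<rangle> * \<langle>i \<leftrightarrow> k\<rangle> = \<langle>i \<leftrightarrow> j\<rangle> * \<langle>j \<leftrightarrow> k\<rangle>"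
    proof -
      have "(\<langle>i \<leftrightarrow> k\<rangle> * \<langle>i \<leftrightarrow> j\<rangle>) \<langle>$\<rangle> a = (\<langle>i \<leftrightarrow> j\<rangle> * \<langle>j \<leftrightarrow> k\<rangle>) \<langle>$\<rangle> a"
        "(\<langle>j \<leftrightarrow> k\<rangle> * \<langle>i \<leftrightarrow> k\<rangle>) \<langle>$\<rangle> a = (\<langle>i \<leftrightarrow> j\<rangle> * \<langle>j \<leftrightarrow> k\<rangle>) \<langle>$\<rangle> a" for a
        using ne by (cases "a = i"; cases "a = j"; cases "a = k"; auto simp: apply_times)+
      thus "\<langle>i \<leftrightarrow> k\<rangle> * \<langle>i \<leftrightarrow> j\<rangle> = \<langle>i \<leftrightarrow> j\<rangle> * \<langle>j \<leftrightarrow> k\<rangle>" "\<langle>j \<leftrightarrow> k\<rangle> * \<langle>i \<leftrightarrow> k\<rangle> = \<langle>i \<leftrightarrow> j\<rangle> * \<langle>j \<leftrightarrow> k\<rangle>"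
        by (auto intro: perm_eqI)
    qed
    let ?l = "\<lambda>i j. lam $ i - lam $ j"
    have skew': "R_factor R b a (?l b' a') = - R_factor R a b (?l a' b')" if "a \<noteq> b" "a' \<noteq> b'" for a b a' b' :: 'n
      using R_factor_skew[OF skew sv[OF that(2)] _ that(1)] sv[OF that(2)[symmetric]] by simp
    \<comment> \<open>The Yang--Baxter equation for the factors $j, i, k$ in this order: the middle factor is $i$,
      which is the common index of $R_{ij}$ and $R_{ik}$ on the left-hand side below.\<close>
    have "R_factor R j i (?l j i) ** R_factor R i k (?l j k) =
        R_factor R j k (?l j k) ** R_factor R j i (?l k i) + R_factor R i k (?l i k) ** R_factor R j k (?l j i)"
      using R_factor_associative_YBE[OF ybe, of j i k "?l j i" "?l j k"] ne
      by (auto simp: sv)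
    moreover have "R_factor R j i (?l j i) = - R_factor R i j (?l i j)"
      "R_factor R j i (?l k i) = - R_factor R i j (?l i k)" "R_factor R k j (?l i j) = - R_factor R j k (?l j i)"
      using ne by (intro skew'; auto)+
    ultimately have "R_factor R i j (?l i j) ** R_factor R i k (?l j k) =
        R_factor R j k (?l j k) ** R_factor R i j (?l i k) + R_factor R i k (?l i k) ** R_factor R k j (?l i j)"
      by (simp add: matrix_mult_uminus_left matrix_mult_uminus_right minus_equation_iff[of "_ ** _"])
    moreover have "j \<noteq> i" "k \<noteq> i" "k \<noteq> j" using ne by auto
    ultimately show ?thesis
      using ne by (simp add: exchange_term_mult sv cycle embed_add distrib_right add.commute)
  qed
qed (rule scalar_central commutator_embed_pderiv_op)+

lemma conjugate_scalar_mult: "b * (scalar c * a) * b' = scalar c * (b * a * b')"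
proof -
  have "b * scalar c = scalar c * b" by (rule scalar_central[symmetric])
  thus ?thesis by (simp flip: mult.assoc)
qed

text \<open>In \<open>perm_vec w lam\<close> the entries at $w(i)$ and $w(j)$ are $\lambda_i$ and $\lambda_j$, so the parameters that
  stay put under conjugation are the right ones after renaming the indices.\<close>

lemma hat_conjugates_dunkl_coord:
  fixes lam :: "complex ^ 'n::finite" and R :: "'d::finite rmatrix"
  assumes sv: "\<And>i j. i \<noteq> j \<Longrightarrow> spectral_value R (lam $ i - lam $ j)"
  shows "hat w * dunkl_coord R hbar g lam i * hat (inverse w) =
    dunkl_coord R hbar g (perm_vec w lam) (w \<langle>$\<rangle> i)"
proof -
  have hat_inverse: "hat w * hat (inverse w) = (1 :: ('n, 'd) crossed)"
    by (simp add: hat_mult hat_1)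
  have conj_pderiv: "hat w * embed (mat (pderiv_op i)) * hat (inverse w) = (embed (mat (pderiv_op (w \<langle>$\<rangle> i))) :: ('n, 'd) crossed)"
    by (simp add: hat_embed hat_action_mat perm_diffop_pderiv_op mult.assoc hat_inverse)
  have conj_exchange: "hat w * exchange_term R lam i j * hat (inverse w) =
      exchange_term R (perm_vec w lam) (w \<langle>$\<rangle> i) (w \<langle>$\<rangle> j)" if "i \<noteq> j" for j
  proof -
    have "w * (\<langle>i \<leftrightarrow> j\<rangle> * inverse w) = \<langle>w \<langle>$\<rangle> i \<leftrightarrow> w \<langle>$\<rangle> j\<rangle>"
    proof (rule perm_eqI)
      fix a
      obtain b where b: "a = w \<langle>$\<rangle> b" by (metis apply_inverse_apply(2))
      show "(w * (\<langle>i \<leftrightarrow> j\<rangle> * inverse w)) \<langle>$\<rangle> a = \<langle>w \<langle>$\<rangle> i \<leftrightarrow> w \<langle>$\<rangle> j\<rangle> \<langle>$\<rangle> a"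
        unfolding b by (cases "b = i"; cases "b = j") (auto simp: apply_times apply_inj)
    qed
    hence "hat w * (hat \<langle>i \<leftrightarrow> j\<rangle> * hat (inverse w)) = (hat \<langle>w \<langle>$\<rangle> i \<leftrightarrow> w \<langle>$\<rangle> j\<rangle> :: ('n, 'd) crossed)"
      by (simp only: hat_mult)
    moreover have "hat w * exchange_term R lam i j * hat (inverse w) =
        (hat w * embed (R_factor R i j (lam $ i - lam $ j))) * (hat \<langle>i \<leftrightarrow> j\<rangle> * hat (inverse w))"
      by (simp only: exchange_term_def mult.assoc)
    ultimately show ?thesis
      by (simp add: hat_embed_R_factor[OF sv[OF that] that] mult.assoc) (simp add: exchange_term_def perm_vec_def)
  qed
  have "(\<Sum>j\<in>UNIV - {i}. hat w * exchange_term R lam i j * hat (inverse w)) =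
      (\<Sum>j\<in>UNIV - {w \<langle>$\<rangle> i}. exchange_term R (perm_vec w lam) (w \<langle>$\<rangle> i) j)"
    by (rule sum.reindex_bij_witness[of _ "\<lambda>j. inverse w \<langle>$\<rangle> j" "\<lambda>j. w \<langle>$\<rangle> j"]) (auto simp: conj_exchange apply_inj)
  hence "hat w * (\<Sum>j\<in>UNIV - {i}. exchange_term R lam i j) * hat (inverse w) =
      (\<Sum>j\<in>UNIV - {w \<langle>$\<rangle> i}. exchange_term R (perm_vec w lam) (w \<langle>$\<rangle> i) j)"
    by (simp add: sum_distrib_left sum_distrib_right)
  thus ?thesis
    by (simp add: dunkl_coord_eq left_diff_distrib right_diff_distrib conjugate_scalar_mult conj_pderiv)
qed

theorem lemma3p1:
  fixes R :: "'d::finite rmatrix"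
    and g hbar :: complex
    and lam :: "complex ^ 'n::finite"
  assumes "rmatrix_meromorphic R"
    and "skew_symmetric R"
    and "associative_YBE R"
    and "unitary_rmatrix R"
    and "regular_rmatrix R"
    and "\<And>i j. i \<noteq> j \<Longrightarrow> spectral_value R (lam $ i - lam $ j)"
  shows "(\<forall>\<xi> \<eta>. commutator (dunkl R hbar g lam \<xi>) (dunkl R hbar g lam \<eta>) = 0) \<and>
         (\<forall>w \<xi>. hat w * dunkl R hbar g lam \<xi> * hat (inverse w)
                = dunkl R hbar g (perm_vec w lam) (perm_vec w \<xi>))"
proof (intro conjI allI)
  fix \<xi> \<eta> :: "complex ^ 'n"
  show "commutator (dunkl R hbar g lam \<xi>) (dunkl R hbar g lam \<eta>) = 0"
    using dunkl_coord_commute[OF assms(2,3,6)]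
    by (simp add: dunkl_def commutator_sum_left commutator_sum_right
        commutator_central_left[OF scalar_central] commutator_central_right[OF scalar_central])
next
  fix w :: "'n perm" and \<xi> :: "complex ^ 'n"
  have "hat w * (scalar (\<xi> $ i) * dunkl_coord R hbar g lam i) * hat (inverse w) =
      scalar (\<xi> $ i) * dunkl_coord R hbar g (perm_vec w lam) (w \<langle>$\<rangle> i)" for i
    by (simp add: conjugate_scalar_mult hat_conjugates_dunkl_coord[OF assms(6)])
  hence "hat w * dunkl R hbar g lam \<xi> * hat (inverse w) =
      (\<Sum>i\<in>UNIV. scalar (\<xi> $ i) * dunkl_coord R hbar g (perm_vec w lam) (w \<langle>$\<rangle> i))"
    by (simp add: dunkl_def sum_distrib_left sum_distrib_right)
  also have "\<dots> = (\<Sum>i\<in>UNIV. scalar (perm_vec w \<xi> $ i) * dunkl_coord R hbar g (perm_vec w lam) i)"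
    by (rule sum.reindex_bij_witness[of _ "\<lambda>i. inverse w \<langle>$\<rangle> i" "\<lambda>i. w \<langle>$\<rangle> i"]) (auto simp: perm_vec_def)
  finally show "hat w * dunkl R hbar g lam \<xi> * hat (inverse w) = dunkl R hbar g (perm_vec w lam) (perm_vec w \<xi>)"
    by (simp add: dunkl_def)
qed

end
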